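(* Let $P,F,A_I,A_O,B_I,B_O$ be finite-dimensional Hilbert spaces with $d_{A_I}=d_{A_O}=:d_A$, $d_{B_I}=d_{B_O}=:d_B$, $d_P=d_F$, and let $W=|w\rangle\langle w|$ be a pure process on $PFA_IA_OB_IB_O$ with induced map $\mathcal{G}$. Then $\mathcal{G}$ admits a decomposition into consistent causal reference frames: there exist finite-dimensional Hilbert spaces $E_A,E_B$ with $d_P=d_Ad_{E_A}=d_Bd_{E_B}$, a frame function $(\Pi_A,\Phi_A)$ for Alice and a frame function $(\Pi_B,\Phi_B)$ for Bob such that for all unitaries $U_A:A_I\to A_O$ and $U_B:B_I\to B_O$, $$\mathcal{G}(U_A,U_B)=\Phi_A(U_B)(U_A\otimes\mathbb{1}^{E_A})\Pi_A(U_B)=\Phi_B(U_A)(U_B\otimes\mathbb{1}^{E_B})\Pi_B(U_A).$$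
   Context: All Hilbert spaces are finite-dimensional with fixed computational bases; juxtaposition denotes tensor product. For a linear map $K:X\to Y$, $|K\rangle\!\rangle^{XY}=\sum_i|i\rangle^X\otimes(K|i\rangle)^Y$. For $|w\rangle=\sum_{x,y}w_{xy}|x\rangle^X|y\rangle^Y$, $|w\rangle^{T_X}:=\sum_{x,y}w_{xy}|y\rangle\langle x|:X\to Y$; for an operator $W$ on $X\otimes Y$, $W^{T_X}$ is its partial transpose on $X$. The Choi operator of $\mathcal{M}:\mathcal{L}(X)\to\mathcal{L}(Y)$ is $\sum_{ij}|i\rangle\langle j|\otimes\mathcal{M}(|i\rangle\langle j|)$. A process matrix is an operator $W$ on $PFA_IA_OB_IB_O$ such that for all finite-dimensional ancilla spaces $A_I',A_O',B_I',B_O'$ and all CPTP maps $\mathcal{M}_x:\mathcal{L}(A_IA_I')\to\mathcal{L}(A_OA_O')$, $\mathcal{M}_y:\mathcal{L}(B_IB_I')\to\mathcal{L}(B_OB_O')$ with Choi operators $M_x,M_y$, the operator $\mathrm{tr}_{A_IA_OB_IB_O}\big(W^{T_{A_IA_OB_IB_O}}(M_x\otimes M_y)\big)$ is the Choi operator of a CPTP map from $PA_I'B_I'$ to $FA_O'B_O'$. It is pure if for all ancilla spaces with $d_{A_I}d_{A_I'}=d_{A_O}d_{A_O'}$, $d_{B_I}d_{B_I'}=d_{B_O}d_{B_O'}$, $d_Pd_{A_I'}d_{B_I'}=d_Fd_{A_O'}d_{B_O'}$ and all unitaries $U:A_IA_I'\to A_OA_O'$, $V:B_IB_I'\to B_OB_O'$,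 the operator $\mathrm{tr}_{A_IA_OB_IB_O}\big(W^{T_{A_IA_OB_IB_O}}(|U\rangle\!\rangle\langle\!\langle U|\otimes|V\rangle\!\rangle\langle\!\langle V|)\big)$ is the Choi operator of a unitary channel. The induced map of $W=|w\rangle\langle w|$ sends linear $U:A_I\to A_O$, $V:B_I\to B_O$ to $\mathcal{G}(U,V):P\to F$ defined by $|\mathcal{G}(U,V)\rangle\!\rangle^{PF}=|w\rangle^{T_{A_IA_OB_IB_O}}(|U\rangle\!\rangle^{A_IA_O}\otimes|V\rangle\!\rangle^{B_IB_O})$. A frame function for Alice is a pair $(\Pi_A,\Phi_A)$ of functions sending linear maps $T_B:B_I\to B_O$ to linear maps $\Pi_A(T_B):P\to A_I\otimes E_A$, $\Phi_A(T_B):A_O\otimes E_A\to F$ which are unitary whenever $T_B$ is unitary (no linearity required); a frame function for Bob is defined symmetrically with $\Pi_B(T_A):P\to B_I\otimes E_B$, $\Phi_B(T_A):B_O\otimes E_B\to F$ for linear $T_A:A_I\to A_O$. *)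

theory Defs
  imports Complex_Main "Jordan_Normal_Form.Matrix"
begin

text \<open>A finite-dimensional Hilbert space of dimension d is C^d with its computational
basis; operators are complex matrices (JNF), and a tensor product of spaces with
dimensions ds = [d1,...,dk] is indexed in mixed radix (big-endian, first factor most
significant), i.e. the Kronecker-product convention.\<close>

fun enc :: "nat list \<Rightarrow> nat list \<Rightarrow> nat" where
  "enc (d # ds) (i # is) = i * prod_list ds + enc ds is"
| "enc _ _ = 0"

fun dec :: "nat list \<Rightarrow> nat \<Rightarrow> nat list" where
  "dec [] r = []"
| "dec (d # ds) r = (r div prod_list ds) mod d # dec ds (r mod prod_list ds)"

definition idx :: "nat list \<Rightarrow> nat \<Rightarrow> nat \<Rightarrow> nat" where
  "idx ds r k = dec ds r ! k"

definition adj :: "complex mat \<Rightarrow> complex mat" where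
  "adj A = mat (dim_col A) (dim_row A) (\<lambda>(i,j). cnj (A $$ (j,i)))"

definition unitary_mat :: "nat \<Rightarrow> nat \<Rightarrow> complex mat \<Rightarrow> bool" where
  "unitary_mat dOut dIn U \<longleftrightarrow> U \<in> carrier_mat dOut dIn \<and> dOut = dIn
     \<and> adj U * U = 1\<^sub>m dIn \<and> U * adj U = 1\<^sub>m dOut"

definition psd :: "nat \<Rightarrow> complex mat \<Rightarrow> bool" where
  "psd d A \<longleftrightarrow> A \<in> carrier_mat d d \<and>
     (\<forall>v \<in> carrier_vec d. Im (conjugate v \<bullet> (A *\<^sub>v v)) = 0 \<and> Re (conjugate v \<bullet> (A *\<^sub>v v)) \<ge> 0)"

definition outer :: "complex vec \<Rightarrow> complex mat" where
  "outer u = mat (dim_vec u) (dim_vec u) (\<lambda>(i,j). u $ i * cnj (u $ j))"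

definition tensor_mat :: "complex mat \<Rightarrow> complex mat \<Rightarrow> complex mat" where
  "tensor_mat A B = mat (dim_row A * dim_row B) (dim_col A * dim_col B)
     (\<lambda>(i,j). A $$ (i div dim_row B, j div dim_col B) * B $$ (i mod dim_row B, j mod dim_col B))"

definition mtrace :: "complex mat \<Rightarrow> complex" where
  "mtrace A = (\<Sum>i<dim_row A. A $$ (i,i))"

text \<open>Linear maps L(X) -> L(Y) are functions on complex matrices, considered on
dX x dX matrices.\<close>

definition choi :: "nat \<Rightarrow> nat \<Rightarrow> (complex mat \<Rightarrow> complex mat) \<Rightarrow> complex mat" where
  "choi dX dY M = mat (dX * dY) (dX * dY)
     (\<lambda>(r,c). M (mat dX dX (\<lambda>(a,b). if a = r div dY \<and> b = c div dY then 1 else 0))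
               $$ (r mod dY, c mod dY))"

definition block :: "nat \<Rightarrow> complex mat \<Rightarrow> nat \<Rightarrow> nat \<Rightarrow> complex mat" where
  "block dX \<rho> k l = mat dX dX (\<lambda>(x,y). \<rho> $$ (k * dX + x, l * dX + y))"

definition id_tensor :: "nat \<Rightarrow> nat \<Rightarrow> nat \<Rightarrow> (complex mat \<Rightarrow> complex mat) \<Rightarrow> complex mat \<Rightarrow> complex mat" where
  "id_tensor n dX dY M \<rho> = mat (n * dY) (n * dY)
     (\<lambda>(r,c). M (block dX \<rho> (r div dY) (c div dY)) $$ (r mod dY, c mod dY))"

definition cptp :: "nat \<Rightarrow> nat \<Rightarrow> (complex mat \<Rightarrow> complex mat) \<Rightarrow> bool" where
  "cptp dX dY M \<longleftrightarrow>
     (\<forall>A \<in> carrier_mat dX dX. M A \<in> carrier_mat dY dY) \<and>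
     (\<forall>A \<in> carrier_mat dX dX. \<forall>B \<in> carrier_mat dX dX. \<forall>c::complex.
        M (c \<cdot>\<^sub>m A + B) = c \<cdot>\<^sub>m M A + M B) \<and>
     (\<forall>n \<rho>. psd (n * dX) \<rho> \<longrightarrow> psd (n * dY) (id_tensor n dX dY M \<rho>)) \<and>
     (\<forall>A \<in> carrier_mat dX dX. mtrace (M A) = mtrace A)"

definition is_choi_cptp :: "nat \<Rightarrow> nat \<Rightarrow> complex mat \<Rightarrow> bool" where
  "is_choi_cptp dX dY C \<longleftrightarrow> (\<exists>M. cptp dX dY M \<and> C = choi dX dY M)"

definition is_choi_unitary :: "nat \<Rightarrow> nat \<Rightarrow> complex mat \<Rightarrow> bool" where
  "is_choi_unitary dX dY C \<longleftrightarrow>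
     (\<exists>T. unitary_mat dY dX T \<and> C = choi dX dY (\<lambda>X. T * X * adj T))"

definition dket :: "complex mat \<Rightarrow> complex vec" where
  "dket K = vec (dim_col K * dim_row K) (\<lambda>r. K $$ (r mod dim_row K, r div dim_row K))"

text \<open>W acts on P F A_I A_O B_I B_O (in this order).  Mx is an operator on
A_I A_I' A_O A_O', My on B_I B_I' B_O B_O' (ancilla dimensions a1 = d_{A_I'},
a2 = d_{A_O'}, b1 = d_{B_I'}, b2 = d_{B_O'}).  The result
tr_{A_I A_O B_I B_O}(W^{T_{A_I A_O B_I B_O}} (Mx \<otimes> My)) is written as an operator on
(P A_I' B_I') \<otimes> (F A_O' B_O'), entrywise:
R[(z,y),(z',y')] = \<Sum>_{x,x'} W[(z,x'),(z',x)] (Mx \<otimes> My)[(x',y),(x,y')].\<close>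

definition link_op :: "nat \<Rightarrow> nat \<Rightarrow> nat \<Rightarrow> nat \<Rightarrow> nat \<Rightarrow> nat \<Rightarrow>
    nat \<Rightarrow> nat \<Rightarrow> nat \<Rightarrow> nat \<Rightarrow> complex mat \<Rightarrow> complex mat \<Rightarrow> complex mat \<Rightarrow> complex mat" where
  "link_op dP dF dAI dAO dBI dBO a1 a2 b1 b2 W Mx My =
    (let ds = [dP, a1, b1, dF, a2, b2];
         D = prod_list ds;
         dW = [dP, dF, dAI, dAO, dBI, dBO];
         dX = [dAI, a1, dAO, a2];
         dY = [dBI, b1, dBO, b2]
     in mat D D (\<lambda>(r,c).
       let p = idx ds r 0; \<alpha> = idx ds r 1; \<gamma> = idx ds r 2;
           f = idx ds r 3; \<beta> = idx ds r 4; \<delta> = idx ds r 5;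
           p' = idx ds c 0; \<alpha>' = idx ds c 1; \<gamma>' = idx ds c 2;
           f' = idx ds c 3; \<beta>' = idx ds c 4; \<delta>' = idx ds c 5
       in (\<Sum>ai<dAI. \<Sum>ao<dAO. \<Sum>bi<dBI. \<Sum>bo<dBO.
           \<Sum>ai'<dAI. \<Sum>ao'<dAO. \<Sum>bi'<dBI. \<Sum>bo'<dBO.
             W $$ (enc dW [p, f, ai', ao', bi', bo'], enc dW [p', f', ai, ao, bi, bo])
           * Mx $$ (enc dX [ai', \<alpha>, ao', \<beta>], enc dX [ai, \<alpha>', ao, \<beta>'])
           * My $$ (enc dY [bi', \<gamma>, bo', \<delta>], enc dY [bi, \<gamma>', bo, \<delta>']))))"

definition process_matrix :: "nat \<Rightarrow> nat \<Rightarrow> nat \<Rightarrow> nat \<Rightarrow> nat \<Rightarrow> nat \<Rightarrow> complex mat \<Rightarrow> bool" where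
  "process_matrix dP dF dAI dAO dBI dBO W \<longleftrightarrow>
     W \<in> carrier_mat (dP*dF*dAI*dAO*dBI*dBO) (dP*dF*dAI*dAO*dBI*dBO) \<and>
     (\<forall>a1 a2 b1 b2 Mx My. a1 \<ge> 1 \<and> a2 \<ge> 1 \<and> b1 \<ge> 1 \<and> b2 \<ge> 1 \<and>
        is_choi_cptp (dAI * a1) (dAO * a2) Mx \<and> is_choi_cptp (dBI * b1) (dBO * b2) My \<longrightarrow>
        is_choi_cptp (dP * a1 * b1) (dF * a2 * b2)
          (link_op dP dF dAI dAO dBI dBO a1 a2 b1 b2 W Mx My))"

definition pure_process :: "nat \<Rightarrow> nat \<Rightarrow> nat \<Rightarrow> nat \<Rightarrow> nat \<Rightarrow> nat \<Rightarrow> complex mat \<Rightarrow> bool" where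
  "pure_process dP dF dAI dAO dBI dBO W \<longleftrightarrow>
     (\<forall>a1 a2 b1 b2 U V. a1 \<ge> 1 \<and> a2 \<ge> 1 \<and> b1 \<ge> 1 \<and> b2 \<ge> 1 \<and>
        dAI * a1 = dAO * a2 \<and> dBI * b1 = dBO * b2 \<and> dP * a1 * b1 = dF * a2 * b2 \<and>
        unitary_mat (dAO * a2) (dAI * a1) U \<and> unitary_mat (dBO * b2) (dBI * b1) V \<longrightarrow>
        is_choi_unitary (dP * a1 * b1) (dF * a2 * b2)
          (link_op dP dF dAI dAO dBI dBO a1 a2 b1 b2 W (outer (dket U)) (outer (dket V))))"

text \<open>Induced map of W = |w><w|: G(U,V) : P -> F, a dF x dP matrix with
|G(U,V)>>^{PF} = |w>^{T_{A_I A_O B_I B_O}} (|U>> \<otimes> |V>>), i.e.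
G(U,V)[f,p] = \<Sum> w[p,f,ai,ao,bi,bo] U[ao,ai] V[bo,bi].\<close>
definition induced_map :: "nat \<Rightarrow> nat \<Rightarrow> nat \<Rightarrow> nat \<Rightarrow> nat \<Rightarrow> nat \<Rightarrow> complex vec \<Rightarrow>
    complex mat \<Rightarrow> complex mat \<Rightarrow> complex mat" where
  "induced_map dP dF dAI dAO dBI dBO w U V = mat dF dP (\<lambda>(f,p).
     \<Sum>ai<dAI. \<Sum>ao<dAO. \<Sum>bi<dBI. \<Sum>bo<dBO.
       w $ enc [dP, dF, dAI, dAO, dBI, dBO] [p, f, ai, ao, bi, bo] * U $$ (ao, ai) * V $$ (bo, bi))"

definition frame_function :: "nat \<Rightarrow> nat \<Rightarrow> nat \<Rightarrow> nat \<Rightarrow> nat \<Rightarrow> nat \<Rightarrow> nat \<Rightarrow>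
    (complex mat \<Rightarrow> complex mat) \<Rightarrow> (complex mat \<Rightarrow> complex mat) \<Rightarrow> bool" where
  "frame_function dP dF dXI dXO dE dYI dYO PiF PhiF \<longleftrightarrow>
     (\<forall>T \<in> carrier_mat dYO dYI. PiF T \<in> carrier_mat (dXI * dE) dP \<and> PhiF T \<in> carrier_mat dF (dXO * dE)) \<and>
     (\<forall>T. unitary_mat dYO dYI T \<longrightarrow>
        unitary_mat (dXI * dE) dP (PiF T) \<and> unitary_mat dF (dXO * dE) (PhiF T))"

end

theory Submission
  imports Defs "Jordan_Normal_Form.Determinant"
begin

text \<open>Fix the unitary in one laboratory and regard the induced map as a linear map \<open>L\<close> of the operation in
the other one. Purity with a qubit ancilla, applied to the unitary \<open>(1/\<surd>2) [[A, A Z], [1, - Z]]\<close>, gives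
\<open>L(A)\<^sup>\<dagger> L(A Z) = L(1)\<^sup>\<dagger> L(Z)\<close>, and \<open>L(A)\<close> is unitary. Hence \<open>X \<mapsto> L(1)\<^sup>\<dagger> L(X)\<close> is multiplicative on
unitaries, and since these span the matrix algebra it is a unital *-homomorphism. Such a homomorphism has
the form \<open>X \<mapsto> K (X \<otimes> 1) K\<^sup>\<dagger>\<close> with \<open>K\<close> unitary, so \<open>L(X) = L(1) K (X \<otimes> 1) K\<^sup>\<dagger>\<close>.\<close>

section \<open>Adjoints and projections\<close>

text \<open>Linearity and preservation of unitaries alone are not enough: transposition has both
  properties and reverses products. The ancilla rules it out, and a qubit suffices because the test
  unitary has 2 x 2 blocks. Pairing its first block column with itself gives unitarity of the
  images; pairing it with the second gives the product rule. Purity fixes the induced unitary only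
  up to a phase. The argument therefore works with inner products of columns, where the phase
  cancels. A frame function may depend on its argument in any way, so a decomposition can be chosen
  separately for each unitary of the other laboratory. Only the multiplicity of the tensor factor
  must be common to all of them, and \<open>dP = dA * r\<close> determines it. The frames of Alice
  and Bob are constructed independently; they are consistent because both decompose the same induced
  map.\<close>

lemma adj_carrier [simp]: "A \<in> carrier_mat n m \<Longrightarrow> adj A \<in> carrier_mat m n"
  by (auto simp: adj_def)

lemma dim_adj [simp]: "dim_row (adj A) = dim_col A" "dim_col (adj A) = dim_row A"
  by (auto simp: adj_def)

lemma index_adj [simp]: "i < dim_col A \<Longrightarrow> j < dim_row A \<Longrightarrow> adj A $$ (i,j) = cnj (A $$ (j,i))"
  by (auto simp: adj_def)

lemma adj_adj [simp]: "adj (adj A) = A"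
  by (rule eq_matI) auto

lemma index_mult_mat_sum:
  assumes "A \<in> carrier_mat n m" "B \<in> carrier_mat m l" "i < n" "j < l"
  shows "(A * B) $$ (i,j) = (\<Sum>k<m. A $$ (i,k) * B $$ (k,j))"
  using assms by (auto simp: scalar_prod_def lessThan_atLeast0 intro!: sum.cong)

lemma adj_mult:
  assumes "A \<in> carrier_mat n m" "B \<in> carrier_mat m l"
  shows "adj (A * B) = adj B * adj A"
proof (rule eq_matI)
  fix i j assume "i < dim_row (adj B * adj A)" "j < dim_col (adj B * adj A)"
  then have ij: "i < l" "j < n" using assms by auto
  have "adj (A * B) $$ (i,j) = cnj ((A * B) $$ (j,i))"
    using assms ij by simp
  also have "\<dots> = (\<Sum>k<m. adj B $$ (i,k) * adj A $$ (k,j))"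
    using assms ij by (subst index_mult_mat_sum[OF assms]) (auto intro!: sum.cong)
  also have "\<dots> = (adj B * adj A) $$ (i,j)"
    using assms ij by (subst index_mult_mat_sum[of _ l m _ n]) auto
  finally show "adj (A * B) $$ (i,j) = (adj B * adj A) $$ (i,j)" .
qed (use assms in auto)

section \<open>Sums and indices over a product of ranges\<close>

lemma sum_lessThan_mult:
  fixes g :: "nat \<Rightarrow> 'a::comm_monoid_add"
  shows "(\<Sum>s<m * n. g s) = (\<Sum>i<m. \<Sum>j<n. g (i * n + j))"
proof (induction m)
  case (Suc m)
  have "(\<Sum>s<Suc m * n. g s) = (\<Sum>s<m * n. g s) + (\<Sum>s=m*n..<m*n+n. g s)"
    by (simp add: lessThan_atLeast0 sum.atLeastLessThan_concat add.commute)
  also have "(\<Sum>s=m*n..<m*n+n. g s) = (\<Sum>j<n. g (m * n + j))"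
    using sum.shift_bounds_nat_ivl[of g 0 "m*n" n]
    by (simp add: lessThan_atLeast0 add.commute)
  finally show ?case using Suc by simp
qed simp

lemma mult_add_less:
  fixes i j :: nat
  assumes "i < m" "j < n"
  shows "i * n + j < m * n"
proof -
  have "i * n + j < Suc i * n" using assms by simp
  also have "\<dots> \<le> m * n" using assms by (intro mult_le_mono1) simp
  finally show ?thesis .
qed

lemma index_split:
  fixes s :: nat
  assumes "s < m * n"
  obtains i j where "i < m" "j < n" "s = i * n + j"
proof
  have "n > 0" using assms by (cases n) auto
  then show "s mod n < n" by simp
  show "s div n < m" using assms by (simp add: less_mult_imp_div_less)
  show "s = s div n * n + s mod n" by simp
qed

lemma mult_add_div:
  fixes i j n :: nat
  shows "j < n \<Longrightarrow> (i * n + j) div n = i"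
  by simp

lemma mult_add_eq_iff:
  fixes i j :: nat
  assumes "a < n" "b < n"
  shows "i * n + a = j * n + b \<longleftrightarrow> i = j \<and> a = b"
proof
  assume "i * n + a = j * n + b"
  then have "(i * n + a) div n = (j * n + b) div n" "(i * n + a) mod n = (j * n + b) mod n" by auto
  then show "i = j \<and> a = b" using assms by simp
qed auto

text \<open>Together with \<open>mtrace_adj_mult\<close> this replaces cyclicity of the trace: both
  traces equal the squared Frobenius norm, also for rectangular matrices. It yields the trace of a
  rank-one projection and, later, the dimension count.\<close>

lemma mtrace_mult_adj:
  assumes "A \<in> carrier_mat n m"
  shows "mtrace (A * adj A) = (\<Sum>i<n. \<Sum>j<m. of_real ((cmod (A $$ (i,j)))\<^sup>2))"
  using assms unfolding mtrace_def
  by (auto simp del: of_real_power index_mult_mat(1) simp: index_mult_mat_sum[of _ n m _ n] complex_norm_square intro!: sum.cong)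

lemma mtrace_adj_mult:
  assumes "A \<in> carrier_mat n m"
  shows "mtrace (adj A * A) = (\<Sum>i<n. \<Sum>j<m. of_real ((cmod (A $$ (i,j)))\<^sup>2))"
  using assms unfolding mtrace_def
  by (subst sum.swap) (auto simp del: of_real_power index_mult_mat(1) simp: index_mult_mat_sum[of _ m n _ m] complex_norm_square mult.commute
      intro!: sum.cong)

text \<open>The induction on a bound for the trace splits off one normalised column of \<open>P\<close> at a time.\<close>

lemma projection_factor:
  assumes "P \<in> carrier_mat m m" "adj P = P" "P * P = P" "Re (mtrace P) \<le> real n"
  shows "\<exists>r. \<exists>B \<in> carrier_mat m r. adj B * B = 1\<^sub>m r \<and> B * adj B = P"
  using assms
proof (induction n arbitrary: P)
  case (0 P)
  \<comment> \<open>Since \<open>P = P * adj P\<close>, the trace is the squared Frobenius norm, so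
    a trace of at most 0 forces every entry to vanish.\<close>
  have zero: "P $$ (i,j) = 0" if "i < m" "j < m" for i j
  proof -
    have "mtrace P = (\<Sum>i<m. \<Sum>j<m. of_real ((cmod (P $$ (i,j)))\<^sup>2))"
      using mtrace_mult_adj[OF 0(1)] 0 by simp
    then have "Re (mtrace P) = (\<Sum>i<m. \<Sum>j<m. (cmod (P $$ (i,j)))\<^sup>2)" by simp
    then have "(\<Sum>i<m. \<Sum>j<m. (cmod (P $$ (i,j)))\<^sup>2) = 0"
      using 0 by (intro antisym sum_nonneg) auto
    then show ?thesis
      using that by (simp add: sum_nonneg_eq_0_iff sum_nonneg)
  qed
  show ?case
    using 0(1) zero
    by (intro exI[of _ "0::nat"] bexI[of _ "0\<^sub>m m 0"] conjI eq_matI)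
      (auto simp: scalar_prod_def)
next
  case (Suc n P)
  note P = Suc.prems(1)
  show ?case
  proof (cases "\<exists>i<m. \<exists>j<m. P $$ (i,j) \<noteq> 0")
    case False
    then show ?thesis
      using P by (intro exI[of _ "0::nat"] bexI[of _ "0\<^sub>m m 0"] conjI eq_matI)
        (auto simp: scalar_prod_def)
  next
    case True
    then obtain i0 j where ij: "i0 < m" "j < m" "P $$ (i0,j) \<noteq> 0" by blast
    define s where "s = (\<Sum>i<m. (cmod (P $$ (i,j)))\<^sup>2)"
    have "(cmod (P $$ (i0,j)))\<^sup>2 \<le> s"
      unfolding s_def using ij by (intro member_le_sum) auto
    then have s: "s > 0" using ij by (smt (verit) zero_less_power2 norm_eq_zero)
    \<comment> \<open>A nonzero column of \<open>P\<close>, divided by its norm; it is fixed by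
      \<open>P\<close> because \<open>P * P = P\<close>.\<close>
    define V where "V = mat m 1 (\<lambda>(i,k). P $$ (i,j) / of_real (sqrt s))"
    have V: "V \<in> carrier_mat m 1" by (simp add: V_def)
    have aV: "adj V \<in> carrier_mat 1 m" using V by simp
    have VV: "adj V * V = 1\<^sub>m 1"
    proof (rule eq_matI)
      fix i k assume ik: "i < dim_row (1\<^sub>m 1 :: complex mat)" "k < dim_col (1\<^sub>m 1 :: complex mat)"
      have "(adj V * V) $$ (0,0) = (\<Sum>x<m. cnj (P $$ (x,j)) * P $$ (x,j) / of_real s)"
        using V aV s by (subst index_mult_mat_sum[OF aV V])
          (auto simp: V_def of_real_mult[symmetric] simp del: of_real_mult intro!: sum.cong)
      also have "\<dots> = (\<Sum>x<m. of_real ((cmod (P $$ (x,j)))\<^sup>2)) / of_real s"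
        by (simp add: sum_divide_distrib complex_norm_square mult.commute del: of_real_power)
      also have "(\<Sum>x<m. of_real ((cmod (P $$ (x,j)))\<^sup>2)) = complex_of_real s"
        by (simp add: s_def)
      also have "complex_of_real s / of_real s = 1" using s by simp
      finally show "(adj V * V) $$ (i,k) = 1\<^sub>m 1 $$ (i,k)" using ik by simp
    qed (use V in auto)
    have PV: "P * V = V"
    proof (rule eq_matI)
      fix i k assume ik: "i < dim_row V" "k < dim_col V"
      then have "(P * V) $$ (i,k) = (\<Sum>x<m. P $$ (i,x) * P $$ (x,j)) / of_real (sqrt s)"
        using V by (subst index_mult_mat_sum[OF P V]) (auto simp: V_def sum_divide_distrib)
      also have "(\<Sum>x<m. P $$ (i,x) * P $$ (x,j)) = (P * P) $$ (i,j)"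
        using ik V ij P by (subst index_mult_mat_sum[OF P P]) auto
      finally show "(P * V) $$ (i,k) = V $$ (i,k)"
        using ik Suc.prems(3) by (simp add: V_def)
    qed (use V P in auto)
    have VP: "adj V * P = adj V"
      using adj_mult[OF P V] PV Suc.prems(2) by simp
    define Q where "Q = V * adj V"
    have Q: "Q \<in> carrier_mat m m" using V by (simp add: Q_def)
    have PQ: "P * Q = Q"
      unfolding Q_def using assoc_mult_mat[OF P V aV] PV by simp
    have QP: "Q * P = Q"
      unfolding Q_def using assoc_mult_mat[OF V aV P] VP by simp
    have QV: "Q * V = V"
      unfolding Q_def using assoc_mult_mat[OF V aV V] VV V by simp
    have QQ: "Q * Q = Q"
      using assoc_mult_mat[OF Q V aV] QV unfolding Q_def[symmetric] by (simp add: Q_def)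
    have aQ: "adj Q = Q" unfolding Q_def using adj_mult[OF V aV] by simp
    \<comment> \<open>\<open>Q\<close> is the rank-one projection onto \<open>V\<close> and lies
      below \<open>P\<close>, that is \<open>P * Q = Q * P = Q\<close>. Hence \<open>P'\<close> is
      again a projection, with trace lower by 1.\<close>
    define P' where "P' = P - Q"
    have P': "P' \<in> carrier_mat m m" using Q by (simp add: P'_def minus_carrier_mat)
    have adjP': "adj P' = P'"
    proof (rule eq_matI)
      fix i k assume ik: "i < dim_row P'" "k < dim_col P'"
      have "cnj (P $$ (k,i)) = P $$ (i,k)" "cnj (Q $$ (k,i)) = Q $$ (i,k)"
        using ik P P' Q index_adj[of i P k] index_adj[of i Q k] aQ Suc.prems(2) by auto
      then show "adj P' $$ (i,k) = P' $$ (i,k)"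
        using ik P Q P' by (simp add: P'_def)
    qed (use P' in auto)
    have idP': "P' * P' = P'"
    proof -
      have "P' * P' = P * (P - Q) - Q * (P - Q)"
        unfolding P'_def by (rule minus_mult_distrib_mat[OF P Q]) (use P Q in auto)
      also have "P * (P - Q) = P - Q"
        using mult_minus_distrib_mat[OF P P Q] Suc.prems(3) PQ by simp
      also have "Q * (P - Q) = 0\<^sub>m m m"
        using mult_minus_distrib_mat[OF Q P Q] QP QQ Q by simp
      finally show ?thesis unfolding P'_def using P Q by (auto intro!: eq_matI)
    qed
    have trQ: "mtrace Q = 1"
    proof -
      have "mtrace Q = mtrace (adj V * V)"
        unfolding Q_def mtrace_mult_adj[OF V] mtrace_adj_mult[OF V] ..
      then show ?thesis using VV by (simp add: mtrace_def)
    qed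
    have "mtrace P' = mtrace P - mtrace Q"
      using P Q unfolding P'_def mtrace_def by (auto simp: sum_subtractf[symmetric] intro!: sum.cong)
    then have "Re (mtrace P') \<le> real n" using trQ Suc.prems(4) by simp
    then obtain r B where B: "B \<in> carrier_mat m r" "adj B * B = 1\<^sub>m r" "B * adj B = P'"
      using Suc.IH[OF P' adjP' idP'] by blast
    have aB: "adj B \<in> carrier_mat r m" using B by simp
    have P'V: "P' * V = 0\<^sub>m m 1"
      unfolding P'_def using minus_mult_distrib_mat[OF P Q V] PV QV V by simp
    \<comment> \<open>The new column is orthogonal to the old ones:
      \<open>adj B = adj B * (B * adj B) = adj B * P'\<close>, and \<open>P'\<close> kills
      \<open>V\<close>.\<close>
    have BV: "adj B * V = 0\<^sub>m r 1"
    proof -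
      have "adj B * V = (adj B * B) * adj B * V" using left_mult_one_mat[OF aB] B(2) by simp
      also have "\<dots> = adj B * (B * adj B * V)"
        using assoc_mult_mat[OF aB B(1) aB] assoc_mult_mat[OF aB mult_carrier_mat[OF B(1) aB] V]
        by simp
      finally show ?thesis unfolding B(3) P'V unfolding right_mult_zero_mat[OF aB] .
    qed
    have VB: "adj V * B = 0\<^sub>m 1 r"
    proof -
      have "adj V * B = adj (adj B * V)" using adj_mult[OF aB V] by simp
      then show ?thesis unfolding BV by (auto intro!: eq_matI)
    qed
    define C where "C = mat m (Suc r) (\<lambda>(x,k). if k < r then B $$ (x,k) else V $$ (x,0))"
    have C: "C \<in> carrier_mat m (Suc r)" by (simp add: C_def)
    have aC: "adj C \<in> carrier_mat (Suc r) m" using C by simp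
    have "adj C * C = 1\<^sub>m (Suc r)"
    proof (rule eq_matI)
      fix i k assume "i < dim_row (1\<^sub>m (Suc r) :: complex mat)" "k < dim_col (1\<^sub>m (Suc r) :: complex mat)"
      then have ik: "i < Suc r" "k < Suc r" by auto
      have e: "(adj C * C) $$ (i,k) = (\<Sum>x<m. cnj (C $$ (x,i)) * C $$ (x,k))"
        using ik C by (subst index_mult_mat_sum[OF aC C]) auto
      have e1: "(\<Sum>x<m. cnj (B $$ (x,i)) * B $$ (x,k)) = (if i = k then 1 else 0)" if "i < r" "k < r"
        using that B index_mult_mat_sum[OF aB B(1), of i k] by simp
      have e2: "(\<Sum>x<m. cnj (B $$ (x,i)) * V $$ (x,0)) = 0" if "i < r"
        using that B V BV index_mult_mat_sum[OF aB V, of i 0] by simp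
      have e3: "(\<Sum>x<m. cnj (V $$ (x,0)) * B $$ (x,k)) = 0" if "k < r"
        using that B V VB index_mult_mat_sum[OF aV B(1), of 0 k] by simp
      have e4: "(\<Sum>x<m. cnj (V $$ (x,0)) * V $$ (x,0)) = 1"
        using V VV index_mult_mat_sum[OF aV V, of 0 0] by simp
      show "(adj C * C) $$ (i,k) = 1\<^sub>m (Suc r) $$ (i,k)"
        unfolding e using ik e1 e2 e3 e4
        by (cases "i < r"; cases "k < r") (auto simp: C_def)
    qed (use C in auto)
    moreover have "C * adj C = P"
    proof (rule eq_matI)
      fix i k assume "i < dim_row P" "k < dim_col P"
      then have ik: "i < m" "k < m" using P by auto
      have "(C * adj C) $$ (i,k)
          = (\<Sum>x<r. B $$ (i,x) * cnj (B $$ (k,x))) + V $$ (i,0) * cnj (V $$ (k,0))"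
        using ik C by (subst index_mult_mat_sum[OF C aC]) (auto simp: C_def)
      also have "(\<Sum>x<r. B $$ (i,x) * cnj (B $$ (k,x))) = P' $$ (i,k)"
        using ik B index_mult_mat_sum[OF B(1) aB, of i k] by simp
      also have "V $$ (i,0) * cnj (V $$ (k,0)) = Q $$ (i,k)"
        using ik V index_mult_mat_sum[OF V aV, of i k] by (simp add: Q_def)
      finally show "(C * adj C) $$ (i,k) = P $$ (i,k)"
        using ik P Q by (simp add: P'_def)
    qed (use C P in auto)
    ultimately show ?thesis using C by blast
  qed
qed

section \<open>Linear maps preserving unitaries\<close>

lemma unitary_matI:
  assumes "U \<in> carrier_mat n n" "adj U * U = 1\<^sub>m n"
  shows "unitary_mat n n U"
  using assms mat_mult_left_right_inverse[of "adj U" n U] by (auto simp: unitary_mat_def)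

lemma unitary_mat_carrier: "unitary_mat n m U \<Longrightarrow> U \<in> carrier_mat n m"
  unfolding unitary_mat_def by (rule conjunct1)

lemma unitary_mat_adj: "unitary_mat n n U \<Longrightarrow> unitary_mat n n (adj U)"
  by (auto simp: unitary_mat_def)

lemma unitary_mat_mult:
  assumes "unitary_mat n n U" "unitary_mat n n V"
  shows "unitary_mat n n (U * V)"
proof (rule unitary_matI)
  have U: "U \<in> carrier_mat n n" "adj U * U = 1\<^sub>m n" and V: "V \<in> carrier_mat n n" "adj V * V = 1\<^sub>m n"
    using assms by (auto simp: unitary_mat_def)
  show "U * V \<in> carrier_mat n n" using U V by simp
  have "adj (U * V) * (U * V) = adj V * (adj U * U * V)"
    unfolding adj_mult[OF U(1) V(1)]
    using assoc_mult_mat[OF adj_carrier[OF V(1)] adj_carrier[OF U(1)] mult_carrier_mat[OF U(1) V(1)]]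
      assoc_mult_mat[OF adj_carrier[OF U(1)] U(1) V(1)] by simp
  then show "adj (U * V) * (U * V) = 1\<^sub>m n" using U V by simp
qed

lemma unitary_mat_one: "unitary_mat n n (1\<^sub>m n)"
proof -
  have "adj (1\<^sub>m n) = 1\<^sub>m n" by (rule eq_matI) auto
  then show ?thesis by (intro unitary_matI) auto
qed

section \<open>Matrix units and the span of the unitaries\<close>

definition matrix_unit :: "nat \<Rightarrow> nat \<Rightarrow> nat \<Rightarrow> complex mat" where
  "matrix_unit d i j = mat d d (\<lambda>(a,b). if a = i \<and> b = j then 1 else 0)"

lemma matrix_unit_carrier [simp]: "matrix_unit d i j \<in> carrier_mat d d"
  by (simp add: matrix_unit_def)

lemma matrix_unit_mult:
  assumes "j < d"
  shows "matrix_unit d i j * matrix_unit d k l = (if j = k then matrix_unit d i l else 0\<^sub>m d d)"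
proof (rule eq_matI)
  fix a b assume "a < dim_row (if j = k then matrix_unit d i l else 0\<^sub>m d d)"
    "b < dim_col (if j = k then matrix_unit d i l else 0\<^sub>m d d)"
  then have ab: "a < d" "b < d" by (auto simp: matrix_unit_def split: if_splits)
  have "(matrix_unit d i j * matrix_unit d k l) $$ (a,b)
      = (\<Sum>x<d. if x = j then (if a = i \<and> j = k \<and> b = l then 1 else 0) else 0)"
    unfolding index_mult_mat_sum[OF matrix_unit_carrier matrix_unit_carrier ab]
    by (rule sum.cong) (use ab in \<open>auto simp: matrix_unit_def\<close>)
  also have "\<dots> = (if j = k then matrix_unit d i l else 0\<^sub>m d d) $$ (a,b)"
    using ab assms by (auto simp: matrix_unit_def)
  finally show "(matrix_unit d i j * matrix_unit d k l) $$ (a,b)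
    = (if j = k then matrix_unit d i l else 0\<^sub>m d d) $$ (a,b)" .
qed (auto simp: matrix_unit_def)

lemma adj_matrix_unit: "adj (matrix_unit d i j) = matrix_unit d j i"
  by (rule eq_matI) (auto simp: matrix_unit_def)

lemma unitary_signed_perm:
  fixes s :: "nat \<Rightarrow> complex"
  assumes "inj_on p {..<d}" "p ` {..<d} \<subseteq> {..<d}" "\<And>b. cnj (s b) * s b = 1"
  shows "unitary_mat d d (mat d d (\<lambda>(a,b). if a = p b then s b else 0))" (is "unitary_mat d d ?U")
proof (rule unitary_matI)
  show U: "?U \<in> carrier_mat d d" by simp
  show "adj ?U * ?U = 1\<^sub>m d"
  proof (rule eq_matI)
    fix a b assume "a < dim_row (1\<^sub>m d :: complex mat)" "b < dim_col (1\<^sub>m d :: complex mat)"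
    then have ab: "a < d" "b < d" by auto
    have "(adj ?U * ?U) $$ (a,b)
        = (\<Sum>k<d. if k = p a then (if p a = p b then cnj (s a) * s b else 0) else 0)"
      unfolding index_mult_mat_sum[OF adj_carrier[OF U] U ab]
      by (rule sum.cong) (use ab in auto)
    also have "\<dots> = 1\<^sub>m d $$ (a,b)"
      using ab assms by (auto simp: inj_on_eq_iff image_subset_iff)
    finally show "(adj ?U * ?U) $$ (a,b) = 1\<^sub>m d $$ (a,b)" .
  qed auto
qed

text \<open>The fact that unitaries span the matrix algebra, cast as an induction rule: a property
  stable under linear combinations passes from unitaries to all matrices. The generators used are
  permutation matrices with signs.\<close>

lemma unitary_span_induct [consumes 1, case_names add smult unitary]:
  assumes X: "X \<in> carrier_mat d d"
    and add: "\<And>X Y. X \<in> carrier_mat d d \<Longrightarrow> Y \<in> carrier_mat d d \<Longrightarrow> P X \<Longrightarrow> P Y \<Longrightarrow> P (X + Y)"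
    and smult: "\<And>a X. X \<in> carrier_mat d d \<Longrightarrow> P X \<Longrightarrow> P (a \<cdot>\<^sub>m X)"
    and unitary: "\<And>U. unitary_mat d d U \<Longrightarrow> P U"
  shows "P X"
proof -
  have unit: "P (matrix_unit d i j)" if ij: "i < d" "j < d" for i j
  proof -
    txt \<open>\<open>E\<^sub>i\<^sub>j = (S - S D) / 2\<close> for the transposition matrix \<open>S\<close> and the reflection \<open>D = 1 - 2 E\<^sub>j\<^sub>j\<close>.\<close>
    let ?N = "\<lambda>s. mat d d (\<lambda>(a,b). if a = Transposition.transpose i j b then s b else (0::complex))"
    let ?s = "\<lambda>b. if b = j then -1 else (1::complex)"
    have t: "Transposition.transpose i j ` {..<d} \<subseteq> {..<d}"
      using ij by (auto simp: Transposition.transpose_def)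
    have P: "P (?N s)" if "\<And>b. cnj (s b) * s b = 1" for s
      using unitary_signed_perm[OF inj_on_subset[OF inj_transpose subset_UNIV] t that]
      by (rule unitary)
    have "P ((1/2) \<cdot>\<^sub>m (?N (\<lambda>_. 1) + (-1) \<cdot>\<^sub>m ?N ?s))"
      by (intro smult add P) auto
    moreover have "(1/2) \<cdot>\<^sub>m (?N (\<lambda>_. 1) + (-1) \<cdot>\<^sub>m ?N ?s) = matrix_unit d i j" (is "?L = _")
    proof (rule eq_matI)
      fix a b assume "a < dim_row (matrix_unit d i j)" "b < dim_col (matrix_unit d i j)"
      then have "a < d" "b < d" by (simp_all add: matrix_unit_def)
      then show "?L $$ (a,b) = matrix_unit d i j $$ (a,b)"
        by (cases "b = j") (simp_all add: matrix_unit_def)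
    qed (simp_all add: matrix_unit_def)
    ultimately show ?thesis by (rule rev_iffD1[OF _ arg_cong])
  qed
  \<comment> \<open>The entries of \<open>X\<close> are restored one position at a time, by
    induction on the set \<open>S\<close> of positions already filled.\<close>
  have "P (mat d d (\<lambda>p. if p \<in> S then X $$ p else 0))"
    if "finite S" "S \<subseteq> {..<d} \<times> {..<d}" for S
    using that
  proof (induction S rule: finite_induct)
    case empty
    \<comment> \<open>The zero matrix is reached as a multiple of a unitary, so the rule needs no
      separate base case.\<close>
    have "P (0 \<cdot>\<^sub>m 1\<^sub>m d)" by (intro smult unitary unitary_mat_one) auto
    moreover have "0 \<cdot>\<^sub>m 1\<^sub>m d = mat d d (\<lambda>p. if p \<in> {} then X $$ p else 0)" by (rule eq_matI) auto
    ultimately show ?case by (rule rev_iffD1[OF _ arg_cong])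
  next
    case (insert p S)
    obtain i j where p: "p = (i,j)" by (cases p)
    let ?M = "mat d d (\<lambda>p. if p \<in> S then X $$ p else 0)"
    have "P (?M + X $$ p \<cdot>\<^sub>m matrix_unit d i j)"
      using insert p by (intro add smult unit) auto
    moreover have "?M + X $$ p \<cdot>\<^sub>m matrix_unit d i j = mat d d (\<lambda>q. if q \<in> insert p S then X $$ q else 0)"
      using insert p by (intro eq_matI) (auto simp: matrix_unit_def)
    ultimately show ?case by (rule rev_iffD1[OF _ arg_cong])
  qed
  from this[of "{..<d} \<times> {..<d}"] have "P (mat d d (\<lambda>p. if p \<in> {..<d} \<times> {..<d} then X $$ p else 0))"
    by simp
  moreover have "mat d d (\<lambda>p. if p \<in> {..<d} \<times> {..<d} then X $$ p else 0) = X"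
    using X by (intro eq_matI) auto
  ultimately show ?thesis by (rule rev_iffD1[OF _ arg_cong])
qed

text \<open>Linear maps are given by coefficients: \<open>c i j x y\<close> is entry
  \<open>(x,y)\<close> of the image of the matrix unit at \<open>(i,j)\<close>. The induced map with
  one slot filled, and its product with a fixed matrix, then have explicit coefficients, and
  linearity holds by construction.\<close>

definition lin_map :: "nat \<Rightarrow> nat \<Rightarrow> (nat \<Rightarrow> nat \<Rightarrow> nat \<Rightarrow> nat \<Rightarrow> complex) \<Rightarrow> complex mat \<Rightarrow> complex mat" where
  "lin_map d m c X = mat m m (\<lambda>(x,y). \<Sum>i<d. \<Sum>j<d. X $$ (i,j) * c i j x y)"

lemma lin_map_carrier [simp]: "lin_map d m c X \<in> carrier_mat m m"
  by (simp add: lin_map_def)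

lemma lin_map_add:
  "X \<in> carrier_mat d d \<Longrightarrow> Y \<in> carrier_mat d d \<Longrightarrow>
    lin_map d m c (X + Y) = lin_map d m c X + lin_map d m c Y"
  by (rule eq_matI) (auto simp: lin_map_def distrib_right sum.distrib)

lemma lin_map_smult:
  "X \<in> carrier_mat d d \<Longrightarrow> lin_map d m c (a \<cdot>\<^sub>m X) = a \<cdot>\<^sub>m lin_map d m c X"
  by (rule eq_matI) (auto simp: lin_map_def sum_distrib_left mult.assoc)

lemma lin_map_zero: "lin_map d m c (0\<^sub>m d d) = 0\<^sub>m m m"
  by (rule eq_matI) (auto simp: lin_map_def)

lemma lin_map_matrix_unit:
  assumes "i < d" "j < d" "x < m" "y < m"
  shows "lin_map d m c (matrix_unit d i j) $$ (x,y) = c i j x y"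
proof -
  have "(\<Sum>b<d. matrix_unit d i j $$ (a,b) * c a b x y)
      = (\<Sum>b<d. if b = j then (if a = i then c a b x y else 0) else 0)" if "a < d" for a
    using that by (intro sum.cong refl) (simp add: matrix_unit_def)
  then show ?thesis using assms unfolding lin_map_def by simp
qed

text \<open>For unitaries, multiplying \<open>cross\<close> by the image of \<open>A\<close> from
  the left gives the product rule, since that image is unitary. Both sides are linear in each
  factor, so the rule extends first in the left factor, with a fixed unitary on the right, and then
  in the right factor.\<close>

lemma unitary_preserving_mult:
  assumes un: "\<And>A. unitary_mat d d A \<Longrightarrow> adj (lin_map d m c A) * lin_map d m c A = 1\<^sub>m m"
    and cross: "\<And>A Z. unitary_mat d d A \<Longrightarrow> unitary_mat d d Z \<Longrightarrow>
      adj (lin_map d m c A) * lin_map d m c (A * Z) = lin_map d m c Z"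
    and X: "X \<in> carrier_mat d d" and Y: "Y \<in> carrier_mat d d"
  shows "lin_map d m c (X * Y) = lin_map d m c X * lin_map d m c Y"
proof -
  let ?p = "lin_map d m c"
  have pc: "?p X \<in> carrier_mat m m" for X by simp
  have unit: "?p (A * Z) = ?p A * ?p Z" if A: "unitary_mat d d A" and Z: "unitary_mat d d Z" for A Z
  proof -
    have "?p A * adj (?p A) = 1\<^sub>m m"
      using un[OF A] by (intro mat_mult_left_right_inverse[of "adj (?p A)"]) auto
    moreover have "?p A * ?p Z = ?p A * adj (?p A) * ?p (A * Z)"
      unfolding cross[OF A Z, symmetric]
      by (rule assoc_mult_mat[symmetric, OF pc adj_carrier[OF pc] pc])
    ultimately show ?thesis using left_mult_one_mat[OF pc] by simp
  qed
  have half: "?p (X * Z) = ?p X * ?p Z" if Z: "unitary_mat d d Z" for Z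
    using X
  proof (induction X rule: unitary_span_induct)
    case (add X Y)
    have Zc: "Z \<in> carrier_mat d d" using Z by (simp add: unitary_mat_def)
    show ?case
      unfolding add_mult_distrib_mat[OF add(1,2) Zc] lin_map_add[OF add(1,2)]
        lin_map_add[OF mult_carrier_mat[OF add(1) Zc] mult_carrier_mat[OF add(2) Zc]]
        add_mult_distrib_mat[OF pc pc pc] add(3,4) ..
  next
    case (smult a X)
    have Zc: "Z \<in> carrier_mat d d" using Z by (simp add: unitary_mat_def)
    show ?case
      unfolding mult_smult_assoc_mat[OF smult(1) Zc] lin_map_smult[OF smult(1)]
        lin_map_smult[OF mult_carrier_mat[OF smult(1) Zc]] mult_smult_assoc_mat[OF pc pc] smult(2) ..
  qed (use unit Z in auto)
  show ?thesis
    using Y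
  proof (induction Y rule: unitary_span_induct)
    case (add Y Z)
    show ?case
      unfolding mult_add_distrib_mat[OF X add(1,2)] lin_map_add[OF add(1,2)]
        lin_map_add[OF mult_carrier_mat[OF X add(1)] mult_carrier_mat[OF X add(2)]]
        mult_add_distrib_mat[OF pc pc pc] add(3,4) ..
  next
    case (smult a Y)
    show ?case
      unfolding mult_smult_distrib[OF X smult(1)] lin_map_smult[OF smult(1)]
        lin_map_smult[OF mult_carrier_mat[OF X smult(1)]] mult_smult_distrib[OF pc pc] smult(2) ..
  qed (use half in auto)
qed

lemma adj_add: "X \<in> carrier_mat n k \<Longrightarrow> Y \<in> carrier_mat n k \<Longrightarrow> adj (X + Y) = adj X + adj Y"
  by (rule eq_matI) auto

lemma adj_smult: "adj (a \<cdot>\<^sub>m X) = cnj a \<cdot>\<^sub>m adj X"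
  by (rule eq_matI) auto

text \<open>For a unitary \<open>U\<close>, take \<open>Z = adj U\<close> in \<open>cross\<close>:
  the product \<open>U * adj U\<close> is the identity, whose image is the identity. Both sides are
  conjugate-linear, so the span of the unitaries suffices.\<close>

lemma unitary_preserving_adj:
  assumes one: "lin_map d m c (1\<^sub>m d) = 1\<^sub>m m"
    and un: "\<And>A. unitary_mat d d A \<Longrightarrow> adj (lin_map d m c A) * lin_map d m c A = 1\<^sub>m m"
    and cross: "\<And>A Z. unitary_mat d d A \<Longrightarrow> unitary_mat d d Z \<Longrightarrow>
      adj (lin_map d m c A) * lin_map d m c (A * Z) = lin_map d m c Z"
    and X: "X \<in> carrier_mat d d"
  shows "lin_map d m c (adj X) = adj (lin_map d m c X)"
  using X
proof (induction X rule: unitary_span_induct)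
  case (add X Y)
  then show ?case by (simp add: adj_add[of _ d d] adj_add[of _ m m] lin_map_add)
next
  case (smult a X)
  then show ?case by (simp add: adj_smult lin_map_smult)
next
  case (unitary U)
  then have "adj (lin_map d m c U) * lin_map d m c (U * adj U) = lin_map d m c (adj U)"
    by (intro cross unitary_mat_adj)
  moreover have "U * adj U = 1\<^sub>m d" using unitary by (simp add: unitary_mat_def)
  ultimately show ?case
    using one right_mult_one_mat[OF adj_carrier[OF lin_map_carrier[of d m c U]]] by simp
qed

section \<open>Decomposition of *-homomorphisms of matrix algebras\<close>

lemma tensor_one_carrier [simp]:
  "X \<in> carrier_mat n k \<Longrightarrow> tensor_mat X (1\<^sub>m r) \<in> carrier_mat (n * r) (k * r)"
  by (auto simp: tensor_mat_def)

lemma index_tensor_one: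
  assumes "X \<in> carrier_mat n k" "i < n" "j < k" "a < r" "b < r"
  shows "tensor_mat X (1\<^sub>m r) $$ (i * r + a, j * r + b) = (if a = b then X $$ (i,j) else 0)"
  using assms mult_add_less[of i n a r] mult_add_less[of j k b r]
  by (auto simp: tensor_mat_def)

lemma tensor_one_one: "tensor_mat (1\<^sub>m n) (1\<^sub>m r) = 1\<^sub>m (n * r)"
proof (rule eq_matI)
  fix s t assume "s < dim_row (1\<^sub>m (n * r) :: complex mat)" "t < dim_col (1\<^sub>m (n * r) :: complex mat)"
  then have st: "s < n * r" "t < n * r" by auto
  obtain i a where i: "i < n" "a < r" "s = i * r + a" by (rule index_split[OF st(1)])
  obtain j b where j: "j < n" "b < r" "t = j * r + b" by (rule index_split[OF st(2)])
  have "s = t \<longleftrightarrow> i = j \<and> a = b"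
    unfolding i(3) j(3) by (rule mult_add_eq_iff[OF i(2) j(2)])
  then show "tensor_mat (1\<^sub>m n) (1\<^sub>m r) $$ (s,t) = 1\<^sub>m (n * r) $$ (s,t)"
    using st i j index_tensor_one[of "1\<^sub>m n" n n i j a r b] by auto
qed (auto simp: tensor_mat_def)

text \<open>The \<open>F i j\<close> behave as matrix units inside the m x m matrices. An
  orthonormal basis \<open>B\<close> of the range of \<open>F 0 0\<close> is carried by
  \<open>F i 0\<close> to one of the range of \<open>F i i\<close>; these bases side by side are the
  columns of \<open>K\<close>, and \<open>r\<close> is the common rank. \<open>K\<close> is only an
  isometry here, because the \<open>F i i\<close> need not add up to the identity.\<close>

lemma tensor_conj_decomp:
  fixes F :: "nat \<Rightarrow> nat \<Rightarrow> complex mat"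
  assumes d: "d \<ge> 1"
    and F: "\<And>i j. i < d \<Longrightarrow> j < d \<Longrightarrow> F i j \<in> carrier_mat m m"
    and adjF: "\<And>i j. i < d \<Longrightarrow> j < d \<Longrightarrow> adj (F i j) = F j i"
    and multF: "\<And>i j k l. i < d \<Longrightarrow> j < d \<Longrightarrow> k < d \<Longrightarrow> l < d \<Longrightarrow>
      F i j * F k l = (if j = k then F i l else 0\<^sub>m m m)"
  shows "\<exists>r. \<exists>K \<in> carrier_mat m (d * r). adj K * K = 1\<^sub>m (d * r) \<and>
    (\<forall>X \<in> carrier_mat d d. \<forall>x<m. \<forall>y<m.
      (K * tensor_mat X (1\<^sub>m r) * adj K) $$ (x,y) = (\<Sum>i<d. \<Sum>j<d. X $$ (i,j) * F i j $$ (x,y)))"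
proof -
  have d0: "0 < d" using d by simp
  have "adj (F 0 0) = F 0 0" "F 0 0 * F 0 0 = F 0 0"
    using adjF[OF d0 d0] multF[OF d0 d0 d0 d0] by auto
  moreover obtain n where "Re (mtrace (F 0 0)) \<le> real n" using real_arch_simple by blast
  ultimately obtain r B where B: "B \<in> carrier_mat m r" "adj B * B = 1\<^sub>m r" "B * adj B = F 0 0"
    using projection_factor[OF F[OF d0 d0]] by blast
  have aB: "adj B \<in> carrier_mat r m" using B by simp
  define G where "G i = F i 0 * B" for i
  have G: "G i \<in> carrier_mat m r" if "i < d" for i
    using F[OF that d0] B unfolding G_def by simp
  have aG: "adj (G i) \<in> carrier_mat r m" if "i < d" for i
    using G[OF that] by simp
  have adjG: "adj (G i) = adj B * F 0 i" if "i < d" for i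
    using adj_mult[OF F[OF that d0] B(1)] adjF[OF that d0] by (simp add: G_def)
  have GG: "G i * adj (G j) = F i j" if ij: "i < d" "j < d" for i j
  proof -
    have "G i * adj (G j) = F i 0 * (B * adj B * F 0 j)"
      unfolding adjG[OF ij(2)] unfolding G_def
      using assoc_mult_mat[OF F[OF ij(1) d0] B(1) mult_carrier_mat[OF aB F[OF d0 ij(2)]]]
        assoc_mult_mat[OF B(1) aB F[OF d0 ij(2)]] by simp
    then show ?thesis using B(3) multF ij d0 by simp
  qed
  have aGG: "adj (G i) * G j = (if i = j then 1\<^sub>m r else 0\<^sub>m r r)" if ij: "i < d" "j < d" for i j
  proof -
    have "adj (G i) * G j = adj B * (F 0 i * F j 0 * B)"
      unfolding adjG[OF ij(1)] unfolding G_def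
      using assoc_mult_mat[OF aB F[OF d0 ij(1)] mult_carrier_mat[OF F[OF ij(2) d0] B(1)]]
        assoc_mult_mat[OF F[OF d0 ij(1)] F[OF ij(2) d0] B(1)] by simp
    also have "F 0 i * F j 0 * B = (if i = j then B * adj B * B else 0\<^sub>m m r)"
      using multF ij d0 B by auto
    also have "B * adj B * B = B"
      using assoc_mult_mat[OF B(1) aB B(1)] B by simp
    finally show ?thesis using aB B(2) by (auto simp: right_mult_zero_mat[OF aB])
  qed
  \<comment> \<open>Column \<open>i * r + a\<close> is column \<open>a\<close> of
    \<open>G i\<close>, which matches the index order of a tensor product whose second factor has
    dimension \<open>r\<close>.\<close>
  define K where "K = mat m (d * r) (\<lambda>(x,s). G (s div r) $$ (x, s mod r))"
  have K: "K \<in> carrier_mat m (d * r)" by (simp add: K_def)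
  have aK: "adj K \<in> carrier_mat (d * r) m" using K by simp
  have Kidx: "K $$ (x, i * r + a) = G i $$ (x,a)" if "x < m" "i < d" "a < r" for x i a
    using that mult_add_less[of i d a r] by (simp add: K_def)
  have Gidx: "(\<Sum>a<r. G i $$ (x,a) * cnj (G j $$ (y,a))) = F i j $$ (x,y)"
    if "i < d" "j < d" "x < m" "y < m" for i j x y
    using that G[OF that(1)] G[OF that(2)] GG[OF that(1,2)]
      index_mult_mat_sum[OF G[OF that(1)] aG[OF that(2)] that(3,4)]
    by simp
  have aGidx: "(\<Sum>x<m. cnj (G i $$ (x,a)) * G j $$ (x,b)) = (if i = j \<and> a = b then 1 else 0)"
    if "i < d" "j < d" "a < r" "b < r" for i j a b
    using that G[OF that(1)] G[OF that(2)] aGG[OF that(1,2)]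
      index_mult_mat_sum[OF aG[OF that(1)] G[OF that(2)] that(3,4)]
    by (simp split: if_splits)
  have "adj K * K = 1\<^sub>m (d * r)"
  proof (rule eq_matI)
    fix s t assume "s < dim_row (1\<^sub>m (d * r) :: complex mat)" "t < dim_col (1\<^sub>m (d * r) :: complex mat)"
    then have st: "s < d * r" "t < d * r" by auto
    obtain i a where i: "i < d" "a < r" "s = i * r + a" by (rule index_split[OF st(1)])
    obtain j b where j: "j < d" "b < r" "t = j * r + b" by (rule index_split[OF st(2)])
    have "(adj K * K) $$ (s,t) = (\<Sum>x<m. cnj (G i $$ (x,a)) * G j $$ (x,b))"
      using st K i j by (subst index_mult_mat_sum[OF aK K]) (auto simp: Kidx)
    also have "\<dots> = tensor_mat (1\<^sub>m d) (1\<^sub>m r) $$ (s,t)"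
      using i j by (simp add: aGidx index_tensor_one[of _ d d])
    finally show "(adj K * K) $$ (s,t) = 1\<^sub>m (d * r) $$ (s,t)"
      by (simp add: tensor_one_one)
  qed (use K in auto)
  moreover have "(K * tensor_mat X (1\<^sub>m r) * adj K) $$ (x,y) = (\<Sum>i<d. \<Sum>j<d. X $$ (i,j) * F i j $$ (x,y))"
    if X: "X \<in> carrier_mat d d" and xy: "x < m" "y < m" for X x y
  proof -
    have T: "tensor_mat X (1\<^sub>m r) \<in> carrier_mat (d * r) (d * r)" using X by simp
    have KT: "(K * tensor_mat X (1\<^sub>m r)) $$ (x, j * r + b) = (\<Sum>i<d. G i $$ (x,b) * X $$ (i,j))"
      if j: "j < d" "b < r" for j b
    proof -
      have "(K * tensor_mat X (1\<^sub>m r)) $$ (x, j * r + b)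
          = (\<Sum>i<d. \<Sum>a<r. if a = b then G i $$ (x,a) * X $$ (i,j) else 0)"
        unfolding index_mult_mat_sum[OF K T xy(1) mult_add_less[OF j]] sum_lessThan_mult
        by (intro sum.cong refl) (use xy j in \<open>auto simp: Kidx index_tensor_one[OF X]\<close>)
      then show ?thesis using j by simp
    qed
    have "(K * tensor_mat X (1\<^sub>m r) * adj K) $$ (x,y)
        = (\<Sum>j<d. \<Sum>b<r. (\<Sum>i<d. G i $$ (x,b) * X $$ (i,j)) * cnj (G j $$ (y,b)))"
      using xy K mult_add_less[of _ d _ r]
      by (subst index_mult_mat_sum[OF mult_carrier_mat[OF K T] aK])
        (auto simp: sum_lessThan_mult KT Kidx simp del: index_mult_mat intro!: sum.cong)
    also have "\<dots> = (\<Sum>j<d. \<Sum>i<d. X $$ (i,j) * (\<Sum>b<r. G i $$ (x,b) * cnj (G j $$ (y,b))))"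
      unfolding sum_distrib_left sum_distrib_right
      by (rule sum.cong[OF refl], subst sum.swap) (simp add: ac_simps)
    also have "\<dots> = (\<Sum>j<d. \<Sum>i<d. X $$ (i,j) * F i j $$ (x,y))"
      using xy by (simp add: Gidx)
    finally show ?thesis by (subst sum.swap)
  qed
  ultimately show ?thesis using K by blast
qed

lemma mtrace_one: "mtrace (1\<^sub>m n) = of_nat n"
  by (simp add: mtrace_def)

lemma star_hom_decomp:
  assumes d: "d \<ge> 1"
    and one: "lin_map d m c (1\<^sub>m d) = 1\<^sub>m m"
    and mult: "\<And>X Y. X \<in> carrier_mat d d \<Longrightarrow> Y \<in> carrier_mat d d \<Longrightarrow>
      lin_map d m c (X * Y) = lin_map d m c X * lin_map d m c Y"
    and adj: "\<And>X. X \<in> carrier_mat d d \<Longrightarrow> lin_map d m c (adj X) = adj (lin_map d m c X)"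
  shows "\<exists>r K. m = d * r \<and> unitary_mat m (d * r) K \<and>
    (\<forall>X \<in> carrier_mat d d. lin_map d m c X = K * tensor_mat X (1\<^sub>m r) * adj K)"
proof -
  define F where "F i j = lin_map d m c (matrix_unit d i j)" for i j
  have "F i j * F k l = (if j = k then F i l else 0\<^sub>m m m)" if "j < d" for i j k l
    using mult[of "matrix_unit d i j" "matrix_unit d k l"] that
    by (auto simp: F_def matrix_unit_mult lin_map_zero)
  moreover have "adj (F i j) = F j i" for i j
    using adj[of "matrix_unit d i j"] by (simp add: F_def adj_matrix_unit)
  moreover have "F i j \<in> carrier_mat m m" for i j
    by (simp add: F_def)
  ultimately obtain r K where K: "K \<in> carrier_mat m (d * r)" "adj K * K = 1\<^sub>m (d * r)"
    and eq: "\<And>X x y. X \<in> carrier_mat d d \<Longrightarrow> x < m \<Longrightarrow> y < m \<Longrightarrow>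
      (K * tensor_mat X (1\<^sub>m r) * adj K) $$ (x,y) = (\<Sum>i<d. \<Sum>j<d. X $$ (i,j) * F i j $$ (x,y))"
    using tensor_conj_decomp[OF d, of F m] by blast
  have dec: "lin_map d m c X = K * tensor_mat X (1\<^sub>m r) * adj K" if X: "X \<in> carrier_mat d d" for X
  proof (rule eq_matI)
    fix x y assume "x < dim_row (K * tensor_mat X (1\<^sub>m r) * adj K)"
      "y < dim_col (K * tensor_mat X (1\<^sub>m r) * adj K)"
    then have xy: "x < m" "y < m" using K by auto
    then show "lin_map d m c X $$ (x,y) = (K * tensor_mat X (1\<^sub>m r) * adj K) $$ (x,y)"
      unfolding eq[OF X xy] by (simp add: F_def lin_map_matrix_unit) (simp add: lin_map_def)
  qed (use K in \<open>auto simp: lin_map_def\<close>)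
  \<comment> \<open>Unitality upgrades the isometry to a unitary: apply the decomposition to the
    identity.\<close>
  have KK: "K * adj K = 1\<^sub>m m"
    using dec[of "1\<^sub>m d"] one K by (simp add: tensor_one_one)
  \<comment> \<open>The squared Frobenius norm of \<open>K\<close>, computed from
    \<open>K * adj K\<close> and from \<open>adj K * K\<close>.\<close>
  have "complex_of_nat m = of_nat (d * r)"
    using mtrace_mult_adj[OF K(1)] mtrace_adj_mult[OF K(1)] K(2) KK by (simp only: mtrace_one)
  then have "m = d * r" unfolding of_nat_eq_iff .
  moreover have "unitary_mat m (d * r) K"
    using K KK \<open>m = d * r\<close> by (simp add: unitary_mat_def)
  ultimately show ?thesis using dec by blast
qed

text \<open>Reduction to the unital case. With \<open>V\<close> the image of the identity, left
  multiplication by \<open>adj V\<close> makes the map unital and leaves all products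
  \<open>adj (L X) * L Y\<close> unchanged, so both hypotheses survive. Undoing it gives
  \<open>R = V * K\<close> and \<open>Q = adj K\<close>.\<close>

lemma completely_unitary_decomp:
  assumes d: "d \<ge> 1"
    and un: "\<And>A. unitary_mat d d A \<Longrightarrow> adj (lin_map d m c A) * lin_map d m c A = 1\<^sub>m m"
    and cross: "\<And>A Z. unitary_mat d d A \<Longrightarrow> unitary_mat d d Z \<Longrightarrow>
      adj (lin_map d m c A) * lin_map d m c (A * Z) = adj (lin_map d m c (1\<^sub>m d)) * lin_map d m c Z"
  shows "\<exists>r Q R. m = d * r \<and> unitary_mat (d * r) m Q \<and> unitary_mat m (d * r) R \<and>
    (\<forall>X \<in> carrier_mat d d. lin_map d m c X = R * tensor_mat X (1\<^sub>m r) * Q)"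
proof -
  define V where "V = lin_map d m c (1\<^sub>m d)"
  have V: "V \<in> carrier_mat m m" "adj V * V = 1\<^sub>m m"
    using un[OF unitary_mat_one] by (auto simp: V_def)
  have VU: "unitary_mat m m V" using V by (rule unitary_matI)
  then have VV: "V * adj V = 1\<^sub>m m" by (simp add: unitary_mat_def)
  have aV: "adj V \<in> carrier_mat m m" using V by simp
  define c' where "c' i j x y = (\<Sum>z<m. adj V $$ (x,z) * c i j z y)" for i j x y
  have L': "lin_map d m c' X = adj V * lin_map d m c X" for X
  proof (rule eq_matI)
    fix x y assume "x < dim_row (adj V * lin_map d m c X)" "y < dim_col (adj V * lin_map d m c X)"
    then have xy: "x < m" "y < m" using V by (auto simp: lin_map_def)
    have "(adj V * lin_map d m c X) $$ (x,y)
        = (\<Sum>z<m. adj V $$ (x,z) * (\<Sum>i<d. \<Sum>j<d. X $$ (i,j) * c i j z y))"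
      using xy by (subst index_mult_mat_sum[OF aV lin_map_carrier]) (auto simp: lin_map_def)
    also have "\<dots> = (\<Sum>i<d. \<Sum>j<d. \<Sum>z<m. adj V $$ (x,z) * (X $$ (i,j) * c i j z y))"
      by (simp add: sum_distrib_left sum.swap[of _ "{..<d}" "{..<m}"])
    also have "\<dots> = lin_map d m c' X $$ (x,y)"
      using xy by (simp add: lin_map_def c'_def sum_distrib_left ac_simps)
    finally show "lin_map d m c' X $$ (x,y) = (adj V * lin_map d m c X) $$ (x,y)" ..
  qed (use V in \<open>auto simp: lin_map_def\<close>)
  have one': "lin_map d m c' (1\<^sub>m d) = 1\<^sub>m m"
    using V(2) unfolding L' V_def .
  have inner: "adj (lin_map d m c' X) * lin_map d m c' Y = adj (lin_map d m c X) * lin_map d m c Y" for X Y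
  proof -
    let ?X = "lin_map d m c X" and ?Y = "lin_map d m c Y"
    have aX: "adj ?X \<in> carrier_mat m m" by simp
    have "adj (lin_map d m c' X) * lin_map d m c' Y = adj ?X * V * (adj V * ?Y)"
      unfolding L' adj_mult[OF aV lin_map_carrier] by simp
    also have "\<dots> = adj ?X * (V * adj V * ?Y)"
      using assoc_mult_mat[OF aX V(1) mult_carrier_mat[OF aV lin_map_carrier[of d m c Y]]]
        assoc_mult_mat[OF V(1) aV lin_map_carrier[of d m c Y]] by simp
    finally show ?thesis using VV left_mult_one_mat[OF lin_map_carrier[of d m c Y]] by simp
  qed
  have un': "adj (lin_map d m c' A) * lin_map d m c' A = 1\<^sub>m m" if "unitary_mat d d A" for A
    unfolding inner using un[OF that] .
  have cross': "adj (lin_map d m c' A) * lin_map d m c' (A * Z) = lin_map d m c' Z"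
    if "unitary_mat d d A" "unitary_mat d d Z" for A Z
    unfolding inner unfolding L' V_def using cross[OF that] .
  obtain r K where m: "m = d * r" and K: "unitary_mat m (d * r) K"
    and dec: "\<And>X. X \<in> carrier_mat d d \<Longrightarrow> lin_map d m c' X = K * tensor_mat X (1\<^sub>m r) * adj K"
    using star_hom_decomp[OF d one' unitary_preserving_mult[OF un' cross']
        unitary_preserving_adj[OF one' un' cross']] by blast
  have Kc: "K \<in> carrier_mat m (d * r)" "adj K \<in> carrier_mat (d * r) m"
    using K by (auto simp: unitary_mat_def)
  have "lin_map d m c X = V * K * tensor_mat X (1\<^sub>m r) * adj K" if X: "X \<in> carrier_mat d d" for X
  proof -
    let ?T = "tensor_mat X (1\<^sub>m r)"
    have T: "?T \<in> carrier_mat (d * r) (d * r)" using X by simp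
    have "lin_map d m c X = V * adj V * lin_map d m c X"
      using VV left_mult_one_mat[OF lin_map_carrier[of d m c X]] by simp
    also have "\<dots> = V * (K * ?T * adj K)"
      using assoc_mult_mat[OF V(1) aV lin_map_carrier[of d m c X]] L' dec[OF X] by simp
    also have "\<dots> = V * (K * ?T) * adj K"
      using assoc_mult_mat[OF V(1) mult_carrier_mat[OF Kc(1) T] Kc(2)] by simp
    also have "V * (K * ?T) = V * K * ?T"
      using assoc_mult_mat[OF V(1) Kc(1) T] by simp
    finally show ?thesis .
  qed
  moreover have "unitary_mat (d * r) m (adj K)" "unitary_mat m (d * r) (V * K)"
    using K unitary_mat_mult[OF VU, of K] unitary_mat_adj[of m K] m by auto
  ultimately show ?thesis using m by blast
qed

section \<open>One open slot with a qubit ancilla\<close>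

text \<open>The ancilla is the second tensor factor, so block \<open>(\<beta>, \<alpha>)\<close> collects the entries whose
row and column are congruent to \<open>\<beta>\<close> and \<open>\<alpha>\<close> modulo 2.\<close>

definition ancilla_block :: "nat \<Rightarrow> complex mat \<Rightarrow> nat \<Rightarrow> nat \<Rightarrow> complex mat" where
  "ancilla_block d W \<beta> \<alpha> = mat d d (\<lambda>(i,j). W $$ (i * 2 + \<beta>, j * 2 + \<alpha>))"

definition assemble_blocks :: "nat \<Rightarrow> (nat \<Rightarrow> nat \<Rightarrow> complex mat) \<Rightarrow> complex mat" where
  "assemble_blocks d X = mat (d * 2) (d * 2)
     (\<lambda>(s,t). of_real (sqrt (1/2)) * X (s mod 2) (t mod 2) $$ (s div 2, t div 2))"

lemma sqrt_half_square: "complex_of_real (sqrt (1/2)) * of_real (sqrt (1/2)) = 1/2"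
  by (simp only: of_real_mult[symmetric] real_sqrt_mult_self) simp

lemma ancilla_block_assemble:
  assumes "X \<beta> \<alpha> \<in> carrier_mat d d" "\<alpha> < 2" "\<beta> < 2"
  shows "ancilla_block d (assemble_blocks d X) \<beta> \<alpha> = of_real (sqrt (1/2)) \<cdot>\<^sub>m X \<beta> \<alpha>"
proof (rule eq_matI)
  fix i j assume "i < dim_row (of_real (sqrt (1/2)) \<cdot>\<^sub>m X \<beta> \<alpha>)" "j < dim_col (of_real (sqrt (1/2)) \<cdot>\<^sub>m X \<beta> \<alpha>)"
  then have ij: "i < d" "j < d" using assms by auto
  then show "ancilla_block d (assemble_blocks d X) \<beta> \<alpha> $$ (i,j) = (of_real (sqrt (1/2)) \<cdot>\<^sub>m X \<beta> \<alpha>) $$ (i,j)"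
    using assms mult_add_less[of i d \<beta> 2] mult_add_less[of j d \<alpha> 2]
    by (simp add: ancilla_block_def assemble_blocks_def)
qed (use assms in \<open>auto simp: ancilla_block_def\<close>)

text \<open>The blocks are taken before normalisation, so each block column has Gram matrix 2; the
  two factors \<open>sqrt (1/2)\<close> cancel it.\<close>

lemma unitary_assemble_blocks:
  assumes X: "\<And>\<beta> \<alpha>. \<alpha> < 2 \<Longrightarrow> \<beta> < 2 \<Longrightarrow> X \<beta> \<alpha> \<in> carrier_mat d d"
    and orth: "\<And>\<alpha> \<alpha>'. \<alpha> < 2 \<Longrightarrow> \<alpha>' < 2 \<Longrightarrow>
      adj (X 0 \<alpha>) * X 0 \<alpha>' + adj (X 1 \<alpha>) * X 1 \<alpha>' = (if \<alpha> = \<alpha>' then 2 \<cdot>\<^sub>m 1\<^sub>m d else 0\<^sub>m d d)"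
  shows "unitary_mat (d * 2) (d * 2) (assemble_blocks d X)" (is "unitary_mat _ _ ?U")
proof (rule unitary_matI)
  show U: "?U \<in> carrier_mat (d * 2) (d * 2)" by (simp add: assemble_blocks_def)
  have Uidx: "?U $$ (i * 2 + \<beta>, j * 2 + \<alpha>) = of_real (sqrt (1/2)) * X \<beta> \<alpha> $$ (i,j)"
    if "i < d" "j < d" "\<beta> < 2" "\<alpha> < 2" for i j \<beta> \<alpha>
    using that mult_add_less[of i d \<beta> 2] mult_add_less[of j d \<alpha> 2]
    by (simp add: assemble_blocks_def)
  show "adj ?U * ?U = 1\<^sub>m (d * 2)"
  proof (rule eq_matI)
    fix s t assume "s < dim_row (1\<^sub>m (d * 2) :: complex mat)" "t < dim_col (1\<^sub>m (d * 2) :: complex mat)"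
    then have st: "s < d * 2" "t < d * 2" by auto
    obtain i \<alpha> where i: "i < d" "\<alpha> < 2" "s = i * 2 + \<alpha>" by (rule index_split[OF st(1)])
    obtain j \<alpha>' where j: "j < d" "\<alpha>' < 2" "t = j * 2 + \<alpha>'" by (rule index_split[OF st(2)])
    have entry: "(\<Sum>x<d. cnj (X \<beta> \<alpha> $$ (x,i)) * X \<beta> \<alpha>' $$ (x,j)) = (adj (X \<beta> \<alpha>) * X \<beta> \<alpha>') $$ (i,j)"
      if "\<beta> < 2" for \<beta>
      using X[OF i(2) that] i(1)
      by (subst index_mult_mat_sum[OF adj_carrier[OF X[OF i(2) that]] X[OF j(2) that] i(1) j(1)]) simp
    have "(adj ?U * ?U) $$ (s,t) = (\<Sum>y<d * 2. cnj (?U $$ (y,s)) * ?U $$ (y,t))"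
      unfolding index_mult_mat_sum[OF adj_carrier[OF U] U st]
      by (rule sum.cong) (use U st in auto)
    also have "\<dots> = (\<Sum>x<d. \<Sum>\<beta><2. (of_real (sqrt (1/2)) * of_real (sqrt (1/2))) *
        (cnj (X \<beta> \<alpha> $$ (x,i)) * X \<beta> \<alpha>' $$ (x,j)))"
      unfolding sum_lessThan_mult i(3) j(3)
      by (intro sum.cong refl) (use i j in \<open>simp add: Uidx\<close>)
    also have "\<dots> = 1/2 * (\<Sum>\<beta><2. \<Sum>x<d. cnj (X \<beta> \<alpha> $$ (x,i)) * X \<beta> \<alpha>' $$ (x,j))"
      unfolding sqrt_half_square by (subst sum.swap) (simp only: sum_distrib_left)
    also have "\<dots> = 1/2 * (adj (X 0 \<alpha>) * X 0 \<alpha>' + adj (X 1 \<alpha>) * X 1 \<alpha>') $$ (i,j)"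
    proof -
      have "(adj (X 0 \<alpha>) * X 0 \<alpha>' + adj (X 1 \<alpha>) * X 1 \<alpha>') $$ (i,j)
          = (adj (X 0 \<alpha>) * X 0 \<alpha>') $$ (i,j) + (adj (X 1 \<alpha>) * X 1 \<alpha>') $$ (i,j)"
        by (rule index_add_mat(1)) (use carrier_matD[OF X[of \<alpha> 1]] carrier_matD[OF X[of \<alpha>' 1]] i j in auto)
      then show ?thesis
        using entry[of 0] entry[of 1] by (simp add: numeral_2_eq_2)
    qed
    also have "\<dots> = 1\<^sub>m (d * 2) $$ (s,t)"
    proof -
      have "s = t \<longleftrightarrow> i = j \<and> \<alpha> = \<alpha>'"
        unfolding i(3) j(3) by (rule mult_add_eq_iff[OF i(2) j(2)])
      then show ?thesis unfolding orth[OF i(2) j(2)] using i(1) j(1) st by simp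
    qed
    finally show "(adj ?U * ?U) $$ (s,t) = 1\<^sub>m (d * 2) $$ (s,t)" .
  qed (use U in auto)
qed

text \<open>Hypothesis \<open>anc\<close> says that applying the map to the system and the identity
  to the qubit turns each unitary \<open>W\<close> into a matrix with orthonormal columns, labelled
  by \<open>(p, \<alpha>)\<close>.\<close>

lemma ancilla_unitary_decomp:
  assumes d: "d \<ge> 1"
    and anc: "\<And>W p \<alpha> p' \<alpha>'. unitary_mat (d * 2) (d * 2) W \<Longrightarrow> p < m \<Longrightarrow> p' < m \<Longrightarrow> \<alpha> < 2 \<Longrightarrow> \<alpha>' < 2 \<Longrightarrow>
      (\<Sum>f<m. \<Sum>\<beta><2. cnj (lin_map d m c (ancilla_block d W \<beta> \<alpha>) $$ (f,p))
          * lin_map d m c (ancilla_block d W \<beta> \<alpha>') $$ (f,p'))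
        = (if p = p' \<and> \<alpha> = \<alpha>' then 1 else 0)"
  shows "\<exists>r Q R. m = d * r \<and> unitary_mat (d * r) m Q \<and> unitary_mat m (d * r) R \<and>
    (\<forall>X \<in> carrier_mat d d. lin_map d m c X = R * tensor_mat X (1\<^sub>m r) * Q)"
proof -
  let ?L = "lin_map d m c"
  have Lc: "?L X \<in> carrier_mat m m" for X by simp
  define ip where "ip X Y p p' = (\<Sum>f<m. cnj (?L X $$ (f,p)) * ?L Y $$ (f,p'))" for X Y p p'
  have ip: "(adj (?L X) * ?L Y) $$ (p,p') = ip X Y p p'" if "p < m" "p' < m" for X Y p p'
    unfolding ip_def index_mult_mat_sum[OF adj_carrier[OF Lc] Lc that]
    by (rule sum.cong) (use that carrier_matD[OF Lc[of X]] in auto)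
  have ip_smult: "ip X (a \<cdot>\<^sub>m Y) p p' = a * ip X Y p p'"
    if "Y \<in> carrier_mat d d" "p < m" "p' < m" for X Y a p p'
    unfolding ip_def lin_map_smult[OF that(1)] sum_distrib_left
    by (rule sum.cong) (use that carrier_matD[OF Lc[of Y]] in auto)
  have key: "ip A (A * Z) p p' - ip (1\<^sub>m d) Z p p' = 0 \<and>
      ip A A p p' + ip (1\<^sub>m d) (1\<^sub>m d) p p' = (if p = p' then 2 else 0)"
    if A: "unitary_mat d d A" and Z: "unitary_mat d d Z" and p: "p < m" "p' < m" for A Z p p'
  proof -
    have Ac: "A \<in> carrier_mat d d" "adj A * A = 1\<^sub>m d" and Zc: "Z \<in> carrier_mat d d" "adj Z * Z = 1\<^sub>m d"
      using A Z by (auto simp: unitary_mat_def)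
    have nZ: "(-1) \<cdot>\<^sub>m Z \<in> carrier_mat d d" using Zc by simp
    txt \<open>Orthogonality of the two block columns of the image of \<open>(1/\<surd>2) [[A, A Z], [1, - Z]]\<close> says that
      \<open>L(A)\<^sup>\<dagger> L(A Z) = L(1)\<^sup>\<dagger> L(Z)\<close>.\<close>
    define X where "X \<beta> \<alpha> = (if \<beta> = 0 then if \<alpha> = 0 then A else A * Z
      else if \<alpha> = 0 then 1\<^sub>m d else (-1) \<cdot>\<^sub>m Z)" for \<beta> \<alpha> :: nat
    have Xc: "X \<beta> \<alpha> \<in> carrier_mat d d" for \<beta> \<alpha>
      using Ac Zc by (simp add: X_def)
    have adj1: "adj (1\<^sub>m d) = 1\<^sub>m d" by (rule eq_matI) auto
    have AAZ: "adj A * (A * Z) = Z"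
      using assoc_mult_mat[OF adj_carrier[OF Ac(1)] Ac(1) Zc(1)] Ac(2) Zc(1) by simp
    have AZA: "adj (A * Z) * A = adj Z"
      unfolding adj_mult[OF Ac(1) Zc(1)]
      using assoc_mult_mat[OF adj_carrier[OF Zc(1)] adj_carrier[OF Ac(1)] Ac(1)] Ac(2)
        right_mult_one_mat[OF adj_carrier[OF Zc(1)]] by simp
    have AZAZ: "adj (A * Z) * (A * Z) = 1\<^sub>m d"
      using unitary_mat_mult[OF A Z] by (simp add: unitary_mat_def)
    have nZnZ: "adj ((-1) \<cdot>\<^sub>m Z) * ((-1) \<cdot>\<^sub>m Z) = 1\<^sub>m d"
      unfolding adj_smult mult_smult_distrib[OF smult_carrier_mat[OF adj_carrier[OF Zc(1)]] Zc(1)]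
        mult_smult_assoc_mat[OF adj_carrier[OF Zc(1)] Zc(1)] Zc(2)
      by (rule eq_matI) auto
    have nZ1: "adj ((-1) \<cdot>\<^sub>m Z) * 1\<^sub>m d = (-1) \<cdot>\<^sub>m adj Z"
      using right_mult_one_mat[OF smult_carrier_mat[OF adj_carrier[OF Zc(1)]]] by (simp add: adj_smult)
    have n1Z: "1\<^sub>m d * ((-1) \<cdot>\<^sub>m Z) = (-1) \<cdot>\<^sub>m Z"
      using left_mult_one_mat[OF nZ] .
    have cancel: "M + (-1) \<cdot>\<^sub>m M = 0\<^sub>m d d" "1\<^sub>m d + 1\<^sub>m d = 2 \<cdot>\<^sub>m (1\<^sub>m d :: complex mat)"
      if "M \<in> carrier_mat d d" for M :: "complex mat"
      using that by (auto intro!: eq_matI)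
    have orth: "adj (X 0 \<alpha>) * X 0 \<alpha>' + adj (X 1 \<alpha>) * X 1 \<alpha>' = (if \<alpha> = \<alpha>' then 2 \<cdot>\<^sub>m 1\<^sub>m d else 0\<^sub>m d d)"
      if \<alpha>: "\<alpha> < 2" "\<alpha>' < 2" for \<alpha> \<alpha>'
    proof -
      consider "\<alpha> = 0" "\<alpha>' = 0" | "\<alpha> = 0" "\<alpha>' = 1" | "\<alpha> = 1" "\<alpha>' = 0" | "\<alpha> = 1" "\<alpha>' = 1"
        using \<alpha> by linarith
      then show ?thesis
      proof cases
        case 1
        then show ?thesis using Ac(2) adj1 cancel(2)[OF Zc(1)] by (simp add: X_def)
      next
        case 2
        then show ?thesis using AAZ adj1 n1Z cancel(1)[OF Zc(1)] by (simp add: X_def)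
      next
        case 3
        then show ?thesis using AZA nZ1 cancel(1)[OF adj_carrier[OF Zc(1)]] by (simp add: X_def)
      next
        case 4
        then show ?thesis using AZAZ nZnZ cancel(2)[OF Zc(1)] by (simp add: X_def)
      qed
    qed
    let ?W = "assemble_blocks d X"
    have W: "unitary_mat (d * 2) (d * 2) ?W"
      by (rule unitary_assemble_blocks) (use Xc orth in auto)
    have blk: "?L (ancilla_block d ?W \<beta> \<alpha>) $$ (f,q) = of_real (sqrt (1/2)) * ?L (X \<beta> \<alpha>) $$ (f,q)"
      if "\<beta> < 2" "\<alpha> < 2" "f < m" "q < m" for \<beta> \<alpha> f q
      unfolding ancilla_block_assemble[OF Xc that(2,1)] lin_map_smult[OF Xc]
      using that carrier_matD[OF Lc[of "X \<beta> \<alpha>"]] by simp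
    \<comment> \<open>Block column 0 against column \<alpha>': the value 1 gives the cross relation,
      the value 0 the norm relation. The latter controls only the sum of the contributions of
      \<open>A\<close> and of the identity.\<close>
    have main: "(ip (X 0 0) (X 0 \<alpha>') p p' + ip (X 1 0) (X 1 \<alpha>') p p') / 2
        = (if p = p' \<and> 0 = \<alpha>' then 1 else 0)" if \<alpha>': "\<alpha>' < 2" for \<alpha>'
    proof -
      have "(\<Sum>f<m. \<Sum>\<beta><2. cnj (?L (ancilla_block d ?W \<beta> 0) $$ (f,p)) * ?L (ancilla_block d ?W \<beta> \<alpha>') $$ (f,p'))
        = (\<Sum>f<m. \<Sum>\<beta><2. (of_real (sqrt (1/2)) * of_real (sqrt (1/2))) *
            (cnj (?L (X \<beta> 0) $$ (f,p)) * ?L (X \<beta> \<alpha>') $$ (f,p')))"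
        by (intro sum.cong refl) (use p \<alpha>' in \<open>simp add: blk\<close>)
      also have "\<dots> = 1/2 * (\<Sum>\<beta><2. ip (X \<beta> 0) (X \<beta> \<alpha>') p p')"
        unfolding sqrt_half_square ip_def by (subst sum.swap) (simp only: sum_distrib_left)
      finally show ?thesis
        using anc[OF W p _ \<alpha>', of 0] by (simp add: numeral_2_eq_2)
    qed
    show ?thesis
      using main[of 0] main[of 1] ip_smult[OF Zc(1) p, of "1\<^sub>m d" "-1"]
      by (auto simp: X_def split: if_splits)
  qed
  \<comment> \<open>With \<open>A\<close> the identity both contributions in the norm relation
    coincide, so each is half of the total; subtracting this settles general
    \<open>A\<close>.\<close>
  have one: "ip (1\<^sub>m d) (1\<^sub>m d) p p' = (if p = p' then 1 else 0)" if "p < m" "p' < m" for p p'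
    using key[OF unitary_mat_one unitary_mat_one that] by (auto split: if_splits)
  show ?thesis
  proof (rule completely_unitary_decomp[OF d])
    fix A assume A: "unitary_mat d d A"
    show "adj (?L A) * ?L A = 1\<^sub>m m"
    proof (rule eq_matI)
      fix p p' assume "p < dim_row (1\<^sub>m m :: complex mat)" "p' < dim_col (1\<^sub>m m :: complex mat)"
      then have p: "p < m" "p' < m" by auto
      show "(adj (?L A) * ?L A) $$ (p,p') = 1\<^sub>m m $$ (p,p')"
        unfolding ip[OF p] using key[OF A A p] one[OF p] p by (auto split: if_splits)
    qed (use carrier_matD[OF Lc[of A]] in auto)
  next
    fix A Z assume A: "unitary_mat d d A" and Z: "unitary_mat d d Z"
    show "adj (?L A) * ?L (A * Z) = adj (?L (1\<^sub>m d)) * ?L Z"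
    proof (rule eq_matI)
      fix p p' assume "p < dim_row (adj (?L (1\<^sub>m d)) * ?L Z)" "p' < dim_col (adj (?L (1\<^sub>m d)) * ?L Z)"
      then have p: "p < m" "p' < m" using carrier_matD[OF Lc] by auto
      show "(adj (?L A) * ?L (A * Z)) $$ (p,p') = (adj (?L (1\<^sub>m d)) * ?L Z) $$ (p,p')"
        unfolding ip[OF p] using key[OF A Z p] by simp
    qed (use carrier_matD[OF Lc] in auto)
  qed
qed

section \<open>Link products of pure operators\<close>

lemma enc_less: "list_all2 (<) is ds \<Longrightarrow> enc ds is < prod_list ds"
proof (induction "is" ds rule: list_all2_induct)
  case (Cons i "is" d ds)
  then show ?case using mult_add_less[of i d "enc ds is" "prod_list ds"] by simp
qed simp

lemma dec_enc: "list_all2 (<) is ds \<Longrightarrow> dec ds (enc ds is) = is"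
proof (induction "is" ds rule: list_all2_induct)
  case (Cons i "is" d ds)
  then show ?case
    using enc_less[OF Cons(2)] mult_add_div[OF enc_less[OF Cons(2)], of i] by simp
qed simp

text \<open>Conjugating a matrix unit by \<open>T\<close> gives column \<open>a\<close> times the
  conjugate of column \<open>b\<close>. The Choi operator is thus the rank-one operator of the
  vectorised \<open>T\<close>, which can be compared with a rank-one link product.\<close>

lemma index_choi_conj:
  assumes T: "T \<in> carrier_mat dY dX" and "a < dX" "b < dX" "s < dY" "t < dY"
  shows "choi dX dY (\<lambda>X. T * X * adj T) $$ (a * dY + s, b * dY + t) = T $$ (s,a) * cnj (T $$ (t,b))"
proof -
  have aT: "adj T \<in> carrier_mat dX dY" using T by simp
  have TE: "(T * matrix_unit dX a b) $$ (s,y) = (if y = b then T $$ (s,a) else 0)" if "y < dX" for y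
  proof -
    have "(T * matrix_unit dX a b) $$ (s,y) = (\<Sum>x<dX. if x = a then (if y = b then T $$ (s,a) else 0) else 0)"
      unfolding index_mult_mat_sum[OF T matrix_unit_carrier assms(4) that]
      by (rule sum.cong) (use that in \<open>auto simp: matrix_unit_def\<close>)
    then show ?thesis using assms by simp
  qed
  have "(T * matrix_unit dX a b * adj T) $$ (s,t) = (\<Sum>y<dX. if y = b then T $$ (s,a) * cnj (T $$ (t,b)) else 0)"
    unfolding index_mult_mat_sum[OF mult_carrier_mat[OF T matrix_unit_carrier] aT assms(4,5)]
    by (rule sum.cong) (use assms in \<open>auto simp: TE simp del: index_mult_mat\<close>)
  then show ?thesis
    using assms mult_add_less[of a dX s dY] mult_add_less[of b dX t dY]
    by (simp add: choi_def matrix_unit_def[symmetric] del: index_mult_mat)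
qed

text \<open>The amplitude of the unitary induced on the remaining spaces; the index list is ordered as in
\<^const>\<open>link_op\<close>, that is \<open>[p, \<alpha>, \<gamma>, f, \<beta>, \<delta>]\<close> for \<open>P A'\<^sub>I B'\<^sub>I F A'\<^sub>O B'\<^sub>O\<close>.\<close>

definition process_amp :: "nat \<Rightarrow> nat \<Rightarrow> nat \<Rightarrow> nat \<Rightarrow> nat \<Rightarrow> nat \<Rightarrow> nat \<Rightarrow> nat \<Rightarrow> complex vec \<Rightarrow>
    complex mat \<Rightarrow> complex mat \<Rightarrow> nat list \<Rightarrow> complex" where
  "process_amp dP dF dAI dAO dBI dBO a b w U V is =
    (\<Sum>ai<dAI. \<Sum>ao<dAO. \<Sum>bi<dBI. \<Sum>bo<dBO.
       w $ enc [dP, dF, dAI, dAO, dBI, dBO] [is ! 0, is ! 3, ai, ao, bi, bo]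
       * U $$ (ao * a + is ! 4, ai * a + is ! 1) * V $$ (bo * b + is ! 5, bi * b + is ! 2))"

lemma dket_enc:
  assumes "U \<in> carrier_mat (dO * a2) (dI * a1)" "i < dI" "x < a1" "j < dO" "y < a2"
  shows "enc [dI, a1, dO, a2] [i, x, j, y] < dim_vec (dket U)"
    and "dket U $ enc [dI, a1, dO, a2] [i, x, j, y] = U $$ (j * a2 + y, i * a1 + x)"
proof -
  have e: "enc [dI, a1, dO, a2] [i, x, j, y] = (i * a1 + x) * (dO * a2) + (j * a2 + y)"
    by (simp add: algebra_simps)
  have lt: "j * a2 + y < dO * a2" "i * a1 + x < dI * a1"
    using assms by (simp_all add: mult_add_less)
  have lt': "(i * a1 + x) * (dO * a2) + (j * a2 + y) < dI * a1 * (dO * a2)"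
    by (rule mult_add_less[OF lt(2,1)])
  show "enc [dI, a1, dO, a2] [i, x, j, y] < dim_vec (dket U)"
    using assms(1) lt' unfolding e by (simp add: dket_def)
  show "dket U $ enc [dI, a1, dO, a2] [i, x, j, y] = U $$ (j * a2 + y, i * a1 + x)"
    unfolding e using assms(1) lt lt' mult_add_div[OF lt(1), of "i * a1 + x"] by (simp add: dket_def)
qed

lemma index_outer: "i < dim_vec u \<Longrightarrow> j < dim_vec u \<Longrightarrow> outer u $$ (i,j) = u $ i * cnj (u $ j)"
  by (simp add: outer_def)

text \<open>All three operators are rank one, so each summand splits: the primed indices occur only
  with the row \<open>r\<close>, the unprimed ones only, conjugated, with the column
  \<open>c\<close>.\<close>

lemma link_op_outer:
  assumes w: "w \<in> carrier_vec (dP*dF*dAI*dAO*dBI*dBO)"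
    and U: "U \<in> carrier_mat (dAO * a) (dAI * a)" and V: "V \<in> carrier_mat (dBO * b) (dBI * b)"
    and r: "list_all2 (<) r [dP, a, b, dF, a, b]" and c: "list_all2 (<) c [dP, a, b, dF, a, b]"
  shows "link_op dP dF dAI dAO dBI dBO a a b b (outer w) (outer (dket U)) (outer (dket V))
      $$ (enc [dP, a, b, dF, a, b] r, enc [dP, a, b, dF, a, b] c)
    = process_amp dP dF dAI dAO dBI dBO a b w U V r * cnj (process_amp dP dF dAI dAO dBI dBO a b w U V c)"
proof -
  let ?ds = "[dP, a, b, dF, a, b]"
  let ?dW = "[dP, dF, dAI, dAO, dBI, dBO]"
  define t where "t is ai ao bi bo = w $ enc ?dW [is ! 0, is ! 3, ai, ao, bi, bo]
       * U $$ (ao * a + is ! 4, ai * a + is ! 1) * V $$ (bo * b + is ! 5, bi * b + is ! 2)"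
    for "is" :: "nat list" and ai ao bi bo
  have amp: "process_amp dP dF dAI dAO dBI dBO a b w U V is
    = (\<Sum>ai<dAI. \<Sum>ao<dAO. \<Sum>bi<dBI. \<Sum>bo<dBO. t is ai ao bi bo)" for "is"
    unfolding process_amp_def t_def ..
  have idx: "idx ?ds (enc ?ds is) k = is ! k" if "list_all2 (<) is ?ds" for "is" k
    using dec_enc[OF that] by (simp add: idx_def)
  have lt: "is ! 0 < dP" "is ! 1 < a" "is ! 2 < b" "is ! 3 < dF" "is ! 4 < a" "is ! 5 < b"
    if "list_all2 (<) is ?ds" for "is"
    using that by (auto simp: list_all2_Cons2)
  have wenc: "enc ?dW [p, f, ai, ao, bi, bo] < dim_vec w"
    if "p < dP" "f < dF" "ai < dAI" "ao < dAO" "bi < dBI" "bo < dBO" for p f ai ao bi bo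
    using enc_less[of "[p, f, ai, ao, bi, bo]" ?dW] that w by (simp add: mult.assoc)
  have "link_op dP dF dAI dAO dBI dBO a a b b (outer w) (outer (dket U)) (outer (dket V)) $$ (enc ?ds r, enc ?ds c)
    = (\<Sum>ai<dAI. \<Sum>ao<dAO. \<Sum>bi<dBI. \<Sum>bo<dBO.
       \<Sum>ai'<dAI. \<Sum>ao'<dAO. \<Sum>bi'<dBI. \<Sum>bo'<dBO.
             outer w $$ (enc ?dW [r ! 0, r ! 3, ai', ao', bi', bo'], enc ?dW [c ! 0, c ! 3, ai, ao, bi, bo])
           * outer (dket U) $$ (enc [dAI, a, dAO, a] [ai', r ! 1, ao', r ! 4], enc [dAI, a, dAO, a] [ai, c ! 1, ao, c ! 4])
           * outer (dket V) $$ (enc [dBI, b, dBO, b] [bi', r ! 2, bo', r ! 5], enc [dBI, b, dBO, b] [bi, c ! 2, bo, c ! 5]))"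
    using enc_less[OF r] enc_less[OF c]
    unfolding link_op_def Let_def by (simp add: idx[OF r] idx[OF c] del: enc.simps prod_list.Cons)
  also have "\<dots> = (\<Sum>ai<dAI. \<Sum>ao<dAO. \<Sum>bi<dBI. \<Sum>bo<dBO.
       \<Sum>ai'<dAI. \<Sum>ao'<dAO. \<Sum>bi'<dBI. \<Sum>bo'<dBO. t r ai' ao' bi' bo' * cnj (t c ai ao bi bo))"
    by (intro sum.cong refl)
      (use lt[OF r] lt[OF c] in \<open>simp add: t_def index_outer wenc dket_enc[OF U] dket_enc[OF V] ac_simps del: enc.simps\<close>)
  also have "\<dots> = process_amp dP dF dAI dAO dBI dBO a b w U V r * cnj (process_amp dP dF dAI dAO dBI dBO a b w U V c)"
    unfolding amp cnj_sum sum_distrib_left[symmetric] sum_distrib_right[symmetric] ..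
  finally show ?thesis .
qed

text \<open>Purity identifies the rank-one link product with the Choi operator of a unitary
  \<open>T\<close>; the claim is \<open>adj T * T = 1\<close> read entrywise in terms of the
  amplitudes.\<close>

lemma pure_process_amp_orthonormal:
  assumes pure: "pure_process dP dF dAI dAO dBI dBO (outer w)"
    and w: "w \<in> carrier_vec (dP*dF*dAI*dAO*dBI*dBO)"
    and dims: "dAI = dAO" "dBI = dBO" "dP = dF" "a \<ge> 1" "b \<ge> 1"
    and U: "unitary_mat (dAO * a) (dAI * a) U" and V: "unitary_mat (dBO * b) (dBI * b) V"
    and lt: "p < dP" "\<alpha> < a" "\<gamma> < b" "p' < dP" "\<alpha>' < a" "\<gamma>' < b"
  shows "(\<Sum>f<dF. \<Sum>\<beta><a. \<Sum>\<delta><b.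
      cnj (process_amp dP dF dAI dAO dBI dBO a b w U V [p, \<alpha>, \<gamma>, f, \<beta>, \<delta>]) *
      process_amp dP dF dAI dAO dBI dBO a b w U V [p', \<alpha>', \<gamma>', f, \<beta>, \<delta>])
    = (if p = p' \<and> \<alpha> = \<alpha>' \<and> \<gamma> = \<gamma>' then 1 else 0)"
proof -
  let ?amp = "process_amp dP dF dAI dAO dBI dBO a b w U V"
  let ?ds = "[dP, a, b, dF, a, b]"
  let ?n = "dF * a * b"
  let ?link = "link_op dP dF dAI dAO dBI dBO a a b b (outer w) (outer (dket U)) (outer (dket V))"
  have "is_choi_unitary (dP * a * b) ?n ?link"
    using pure U V dims unfolding pure_process_def by blast
  then obtain T where T: "unitary_mat ?n (dP * a * b) T" and link: "?link = choi (dP * a * b) ?n (\<lambda>X. T * X * adj T)"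
    unfolding is_choi_unitary_def by blast
  have Tc: "T \<in> carrier_mat ?n (dP * a * b)" "adj T * T = 1\<^sub>m (dP * a * b)"
    using T by (auto simp: unitary_mat_def)
  \<comment> \<open>Positions in the input P A_I' B_I' and in the output F A_O' B_O'. The six-fold
    index is \<open>col * ?n + row\<close>, the index layout of \<open>choi\<close>.\<close>
  define col where "col p \<alpha> \<gamma> = (p * a + \<alpha>) * b + \<gamma>" for p \<alpha> \<gamma>
  define row where "row f \<beta> \<delta> = (f * a + \<beta>) * b + \<delta>" for f \<beta> \<delta>
  have col_less: "col p \<alpha> \<gamma> < dP * a * b" if "p < dP" "\<alpha> < a" "\<gamma> < b" for p \<alpha> \<gamma>
    using that unfolding col_def by (intro mult_add_less)
  have row_less: "row f \<beta> \<delta> < ?n" if "f < dF" "\<beta> < a" "\<delta> < b" for f \<beta> \<delta>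
    using that unfolding row_def by (intro mult_add_less)
  have col_inj: "col p \<alpha> \<gamma> = col p' \<alpha>' \<gamma>' \<longleftrightarrow> p = p' \<and> \<alpha> = \<alpha>' \<and> \<gamma> = \<gamma>'"
  proof -
    have e: "col p \<alpha> \<gamma> = enc [dP, a, b] [p, \<alpha>, \<gamma>]" for p \<alpha> \<gamma>
      by (simp add: col_def algebra_simps)
    have "dec [dP, a, b] (col p \<alpha> \<gamma>) = [p, \<alpha>, \<gamma>]" "dec [dP, a, b] (col p' \<alpha>' \<gamma>') = [p', \<alpha>', \<gamma>']"
      unfolding e using lt by (simp_all only: dec_enc list_all2_Cons list_all2_Nil)
    then show ?thesis by fastforce
  qed
  have enc: "enc ?ds [p, \<alpha>, \<gamma>, f, \<beta>, \<delta>] = col p \<alpha> \<gamma> * ?n + row f \<beta> \<delta>" for p \<alpha> \<gamma> f \<beta> \<delta>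
    by (simp add: col_def row_def algebra_simps)
  txt \<open>The link product determines \<open>T\<close> only up to a phase, which cancels in these products.\<close>
  have entry: "cnj (?amp [p, \<alpha>, \<gamma>, f, \<beta>, \<delta>]) * ?amp [p', \<alpha>', \<gamma>', f, \<beta>, \<delta>]
      = adj T $$ (col p \<alpha> \<gamma>, row f \<beta> \<delta>) * T $$ (row f \<beta> \<delta>, col p' \<alpha>' \<gamma>')"
    if f: "f < dF" "\<beta> < a" "\<delta> < b" for f \<beta> \<delta>
  proof -
    have "?amp [p', \<alpha>', \<gamma>', f, \<beta>, \<delta>] * cnj (?amp [p, \<alpha>, \<gamma>, f, \<beta>, \<delta>])
        = ?link $$ (enc ?ds [p', \<alpha>', \<gamma>', f, \<beta>, \<delta>], enc ?ds [p, \<alpha>, \<gamma>, f, \<beta>, \<delta>])"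
      by (rule link_op_outer[symmetric]) (use w U V lt f in \<open>auto simp: unitary_mat_def\<close>)
    also have "\<dots> = T $$ (row f \<beta> \<delta>, col p' \<alpha>' \<gamma>') * cnj (T $$ (row f \<beta> \<delta>, col p \<alpha> \<gamma>))"
      unfolding link enc
      by (rule index_choi_conj[OF Tc(1)]) (use col_less row_less lt f in auto)
    finally show ?thesis
      using Tc(1) col_less[OF lt(1-3)] row_less[OF f] by (simp add: mult.commute)
  qed
  have "(\<Sum>f<dF. \<Sum>\<beta><a. \<Sum>\<delta><b. cnj (?amp [p, \<alpha>, \<gamma>, f, \<beta>, \<delta>]) * ?amp [p', \<alpha>', \<gamma>', f, \<beta>, \<delta>])
    = (\<Sum>s<?n. adj T $$ (col p \<alpha> \<gamma>, s) * T $$ (s, col p' \<alpha>' \<gamma>'))"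
    unfolding sum_lessThan_mult by (intro sum.cong refl) (simp add: entry row_def)
  also have "\<dots> = (adj T * T) $$ (col p \<alpha> \<gamma>, col p' \<alpha>' \<gamma>')"
    using index_mult_mat_sum[OF adj_carrier[OF Tc(1)] Tc(1) col_less[OF lt(1-3)] col_less[OF lt(4-6)]] ..
  also have "\<dots> = (if p = p' \<and> \<alpha> = \<alpha>' \<and> \<gamma> = \<gamma>' then 1 else 0)"
    unfolding Tc(2) using col_less[OF lt(1-3)] col_less[OF lt(4-6)] by (simp add: col_inj)
  finally show ?thesis .
qed

section \<open>Frame functions\<close>

lemma sum_swap3:
  fixes f :: "'a \<Rightarrow> 'b \<Rightarrow> 'c \<Rightarrow> 'd::comm_monoid_add"
  shows "(\<Sum>a\<in>A. \<Sum>b\<in>B. \<Sum>c\<in>C. f a b c) = (\<Sum>c\<in>C. \<Sum>a\<in>A. \<Sum>b\<in>B. f a b c)"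
proof -
  have "(\<Sum>a\<in>A. \<Sum>b\<in>B. \<Sum>c\<in>C. f a b c) = (\<Sum>a\<in>A. \<Sum>c\<in>C. \<Sum>b\<in>B. f a b c)"
    by (rule sum.cong[OF refl], rule sum.swap)
  also have "\<dots> = (\<Sum>c\<in>C. \<Sum>a\<in>A. \<Sum>b\<in>B. f a b c)" by (rule sum.swap)
  finally show ?thesis .
qed

lemma sum_swap4:
  fixes f :: "'a \<Rightarrow> 'b \<Rightarrow> 'c \<Rightarrow> 'd \<Rightarrow> 'e::comm_monoid_add"
  shows "(\<Sum>a\<in>A. \<Sum>b\<in>B. \<Sum>c\<in>C. \<Sum>d\<in>D. f a b c d) = (\<Sum>d\<in>D. \<Sum>c\<in>C. \<Sum>a\<in>A. \<Sum>b\<in>B. f a b c d)"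
proof -
  have "(\<Sum>a\<in>A. \<Sum>b\<in>B. \<Sum>c\<in>C. \<Sum>d\<in>D. f a b c d) = (\<Sum>c\<in>C. \<Sum>a\<in>A. \<Sum>b\<in>B. \<Sum>d\<in>D. f a b c d)"
    by (rule sum_swap3)
  also have "\<dots> = (\<Sum>c\<in>C. \<Sum>d\<in>D. \<Sum>a\<in>A. \<Sum>b\<in>B. f a b c d)"
    by (rule sum.cong[OF refl], rule sum_swap3)
  also have "\<dots> = (\<Sum>d\<in>D. \<Sum>c\<in>C. \<Sum>a\<in>A. \<Sum>b\<in>B. f a b c d)" by (rule sum.swap)
  finally show ?thesis .
qed

text \<open>Row \<open>i\<close> of \<open>U\<close> is the output index and column \<open>j\<close>
  the input index, while \<open>w\<close> lists input before output; hence the order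
  \<open>j, i\<close>.\<close>

lemma induced_map_Alice:
  "induced_map dP dP dA dA dBI dBO w U V = lin_map dA dP
     (\<lambda>i j f p. \<Sum>bi<dBI. \<Sum>bo<dBO. w $ enc [dP, dP, dA, dA, dBI, dBO] [p, f, j, i, bi, bo] * V $$ (bo, bi)) U"
  unfolding induced_map_def lin_map_def sum_distrib_left
  by (rule cong_mat[OF refl refl], simp only: prod.case, subst sum.swap) (simp add: ac_simps)

lemma induced_map_Bob:
  "induced_map dP dP dAI dAO dB dB w U V = lin_map dB dP
     (\<lambda>i j f p. \<Sum>ai<dAI. \<Sum>ao<dAO. w $ enc [dP, dP, dAI, dAO, dB, dB] [p, f, ai, ao, j, i] * U $$ (ao, ai)) V"
  unfolding induced_map_def lin_map_def sum_distrib_left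
  by (rule cong_mat[OF refl refl], simp only: prod.case, subst sum_swap4) (simp add: ac_simps)

text \<open>With a qubit for Alice and a one-dimensional ancilla for Bob (index 0), the amplitudes
  are the ancilla blocks of the extended map, as \<open>ancilla_unitary_decomp\<close> expects
  them.\<close>

lemma process_amp_Alice:
  assumes "f < dP" "p < dP" "\<alpha> < 2" "\<beta> < 2"
  shows "process_amp dP dP dA dA dBI dBO 2 1 w W V [p, \<alpha>, 0, f, \<beta>, 0]
    = induced_map dP dP dA dA dBI dBO w (ancilla_block dA W \<beta> \<alpha>) V $$ (f, p)"
  using assms by (simp add: process_amp_def induced_map_def ancilla_block_def eval_nat_numeral)

lemma process_amp_Bob:
  assumes "f < dP" "p < dP" "\<alpha> < 2" "\<beta> < 2"
  shows "process_amp dP dP dAI dAO dB dB 1 2 w U W [p, 0, \<alpha>, f, 0, \<beta>]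
    = induced_map dP dP dAI dAO dB dB w U (ancilla_block dB W \<beta> \<alpha>) $$ (f, p)"
  using assms by (simp add: process_amp_def induced_map_def ancilla_block_def eval_nat_numeral)

lemma pure_process_Alice_decomp:
  assumes pure: "pure_process dP dP dA dA dB dB (outer w)"
    and w: "w \<in> carrier_vec (dP*dP*dA*dA*dB*dB)" and d: "dA \<ge> 1"
    and V: "unitary_mat dB dB V"
  shows "\<exists>r Q R. dP = dA * r \<and> unitary_mat (dA * r) dP Q \<and> unitary_mat dP (dA * r) R \<and>
    (\<forall>U \<in> carrier_mat dA dA. induced_map dP dP dA dA dB dB w U V = R * tensor_mat U (1\<^sub>m r) * Q)"
  unfolding induced_map_Alice
proof (rule ancilla_unitary_decomp[OF d], fold induced_map_Alice)
  fix W :: "complex mat" and p \<alpha> p' \<alpha>' :: nat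
  assume W: "unitary_mat (dA * 2) (dA * 2) W" and lt: "p < dP" "p' < dP" "\<alpha> < 2" "\<alpha>' < 2"
  have "(\<Sum>f<dP. \<Sum>\<beta><2. cnj (induced_map dP dP dA dA dB dB w (ancilla_block dA W \<beta> \<alpha>) V $$ (f,p))
        * induced_map dP dP dA dA dB dB w (ancilla_block dA W \<beta> \<alpha>') V $$ (f,p'))
    = (\<Sum>f<dP. \<Sum>\<beta><2. \<Sum>\<delta><1. cnj (process_amp dP dP dA dA dB dB 2 1 w W V [p, \<alpha>, 0, f, \<beta>, \<delta>])
        * process_amp dP dP dA dA dB dB 2 1 w W V [p', \<alpha>', 0, f, \<beta>, \<delta>])"
    by (intro sum.cong refl) (use lt in \<open>simp add: process_amp_Alice[unfolded One_nat_def]\<close>)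
  also have "\<dots> = (if p = p' \<and> \<alpha> = \<alpha>' then 1 else 0)"
    using pure_process_amp_orthonormal[OF pure w, of 2 1 W V p \<alpha> 0 p' \<alpha>' 0] W V lt by simp
  finally show "(\<Sum>f<dP. \<Sum>\<beta><2. cnj (induced_map dP dP dA dA dB dB w (ancilla_block dA W \<beta> \<alpha>) V $$ (f,p))
        * induced_map dP dP dA dA dB dB w (ancilla_block dA W \<beta> \<alpha>') V $$ (f,p'))
    = (if p = p' \<and> \<alpha> = \<alpha>' then 1 else 0)" .
qed

lemma pure_process_Bob_decomp:
  assumes pure: "pure_process dP dP dA dA dB dB (outer w)"
    and w: "w \<in> carrier_vec (dP*dP*dA*dA*dB*dB)" and d: "dB \<ge> 1"
    and U: "unitary_mat dA dA U"
  shows "\<exists>r Q R. dP = dB * r \<and> unitary_mat (dB * r) dP Q \<and> unitary_mat dP (dB * r) R \<and>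
    (\<forall>V \<in> carrier_mat dB dB. induced_map dP dP dA dA dB dB w U V = R * tensor_mat V (1\<^sub>m r) * Q)"
  unfolding induced_map_Bob
proof (rule ancilla_unitary_decomp[OF d], fold induced_map_Bob)
  fix W :: "complex mat" and p \<alpha> p' \<alpha>' :: nat
  assume W: "unitary_mat (dB * 2) (dB * 2) W" and lt: "p < dP" "p' < dP" "\<alpha> < 2" "\<alpha>' < 2"
  have "(\<Sum>f<dP. \<Sum>\<beta><2. cnj (induced_map dP dP dA dA dB dB w U (ancilla_block dB W \<beta> \<alpha>) $$ (f,p))
        * induced_map dP dP dA dA dB dB w U (ancilla_block dB W \<beta> \<alpha>') $$ (f,p'))
    = (\<Sum>f<dP. \<Sum>\<delta><1. \<Sum>\<beta><2. cnj (process_amp dP dP dA dA dB dB 1 2 w U W [p, 0, \<alpha>, f, \<delta>, \<beta>])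
        * process_amp dP dP dA dA dB dB 1 2 w U W [p', 0, \<alpha>', f, \<delta>, \<beta>])"
    by (simp, intro sum.cong refl) (use lt in \<open>simp add: process_amp_Bob[unfolded One_nat_def]\<close>)
  also have "\<dots> = (if p = p' \<and> \<alpha> = \<alpha>' then 1 else 0)"
    using pure_process_amp_orthonormal[OF pure w, of 1 2 U W p 0 \<alpha> p' 0 \<alpha>'] W U lt by simp
  finally show "(\<Sum>f<dP. \<Sum>\<beta><2. cnj (induced_map dP dP dA dA dB dB w U (ancilla_block dB W \<beta> \<alpha>) $$ (f,p))
        * induced_map dP dP dA dA dB dB w U (ancilla_block dB W \<beta> \<alpha>') $$ (f,p'))
    = (if p = p' \<and> \<alpha> = \<alpha>' then 1 else 0)" .
qed

text \<open>The factors are chosen for each unitary \<open>T\<close> on its own, as a pair because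
  they belong together; \<open>dE\<close> must serve all \<open>T\<close>.\<close>

lemma frame_function_exists:
  assumes dims: "dP \<ge> 1" "dX \<ge> 1"
    and dec: "\<And>T. unitary_mat dY dY T \<Longrightarrow>
      \<exists>r Q R. dP = dX * r \<and> unitary_mat (dX * r) dP Q \<and> unitary_mat dP (dX * r) R \<and>
        (\<forall>U \<in> carrier_mat dX dX. G U T = R * tensor_mat U (1\<^sub>m r) * Q)"
  shows "\<exists>dE \<Psi> \<Phi>. dE \<ge> 1 \<and> dP = dX * dE \<and> frame_function dP dP dX dX dE dY dY \<Psi> \<Phi> \<and>
    (\<forall>U T. unitary_mat dX dX U \<and> unitary_mat dY dY T \<longrightarrow>
      G U T = \<Phi> T * tensor_mat U (1\<^sub>m dE) * \<Psi> T)"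
proof -
  obtain dE where dE: "dP = dX * dE"
    using dec[OF unitary_mat_one] by blast
  let ?P = "\<lambda>T QR. unitary_mat (dX * dE) dP (fst QR) \<and> unitary_mat dP (dX * dE) (snd QR) \<and>
      (\<forall>U \<in> carrier_mat dX dX. G U T = snd QR * tensor_mat U (1\<^sub>m dE) * fst QR)"
  have "\<forall>T. \<exists>QR. unitary_mat dY dY T \<longrightarrow> ?P T QR"
  proof (intro allI)
    fix T
    show "\<exists>QR. unitary_mat dY dY T \<longrightarrow> ?P T QR"
    proof (cases "unitary_mat dY dY T")
      case True
      then obtain r Q R where r: "dP = dX * r" "unitary_mat (dX * r) dP Q" "unitary_mat dP (dX * r) R"
        "\<forall>U \<in> carrier_mat dX dX. G U T = R * tensor_mat U (1\<^sub>m r) * Q"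
        using dec by blast
      \<comment> \<open>The multiplicity cannot vary with \<open>T\<close>: it is determined by
        \<open>dP = dX * r\<close> with \<open>dX\<close> positive.\<close>
      moreover have "r = dE" using r(1) dE dims by simp
      ultimately show ?thesis by (intro exI[of _ "(Q, R)"]) simp
    qed simp
  qed
  then obtain QR where QR: "\<forall>T. unitary_mat dY dY T \<longrightarrow> ?P T (QR T)"
    by (rule choice[THEN exE])
  \<comment> \<open>Outside the unitaries only the matrix dimensions are prescribed, so zero
    matrices of the right shape serve as default values.\<close>
  define \<Psi> where "\<Psi> T = (if unitary_mat dY dY T then fst (QR T) else 0\<^sub>m (dX * dE) dP)" for T
  define \<Phi> where "\<Phi> T = (if unitary_mat dY dY T then snd (QR T) else 0\<^sub>m dP (dX * dE))" for T
  have "frame_function dP dP dX dX dE dY dY \<Psi> \<Phi>"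
    using QR unfolding frame_function_def \<Psi>_def \<Phi>_def by (auto intro: unitary_mat_carrier)
  moreover have "G U T = \<Phi> T * tensor_mat U (1\<^sub>m dE) * \<Psi> T"
    if "unitary_mat dX dX U" "unitary_mat dY dY T" for U T
    using QR that(2) unitary_mat_carrier[OF that(1)] by (simp add: \<Psi>_def \<Phi>_def)
  moreover have "dE \<ge> 1" using dE dims by (cases dE) auto
  ultimately show ?thesis
    using dE by (intro exI[of _ dE] exI[of _ \<Psi>] exI[of _ \<Phi>]) simp
qed

theorem theorem4:
  fixes dP dF dAI dAO dBI dBO :: nat and w :: "complex vec"
  assumes dims_pos: "dP \<ge> 1" "dF \<ge> 1" "dAI \<ge> 1" "dAO \<ge> 1" "dBI \<ge> 1" "dBO \<ge> 1"
    and dA: "dAI = dAO" and dB: "dBI = dBO" and dPF: "dP = dF"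
    and w_dim: "w \<in> carrier_vec (dP*dF*dAI*dAO*dBI*dBO)"
    and proc: "process_matrix dP dF dAI dAO dBI dBO (outer w)"
    and pure: "pure_process dP dF dAI dAO dBI dBO (outer w)"
  shows "\<exists>dEA dEB \<Pi>A \<Phi>A \<Pi>B \<Phi>B.
     dEA \<ge> 1 \<and> dEB \<ge> 1 \<and> dP = dAI * dEA \<and> dP = dBI * dEB \<and>
     frame_function dP dF dAI dAO dEA dBI dBO \<Pi>A \<Phi>A \<and>
     frame_function dP dF dBI dBO dEB dAI dAO \<Pi>B \<Phi>B \<and>
     (\<forall>UA UB. unitary_mat dAO dAI UA \<and> unitary_mat dBO dBI UB \<longrightarrow>
        induced_map dP dF dAI dAO dBI dBO w UA UB
          = \<Phi>A UB * tensor_mat UA (1\<^sub>m dEA) * \<Pi>A UB \<and>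
        induced_map dP dF dAI dAO dBI dBO w UA UB
          = \<Phi>B UA * tensor_mat UB (1\<^sub>m dEB) * \<Pi>B UA)"
proof -
  have pure': "pure_process dP dP dAI dAI dBI dBI (outer w)"
    and w': "w \<in> carrier_vec (dP*dP*dAI*dAI*dBI*dBI)"
    using pure w_dim dA dB dPF by simp_all
  let ?G = "induced_map dP dP dAI dAI dBI dBI w"
  obtain dEA \<Pi>A \<Phi>A where A: "dEA \<ge> 1" "dP = dAI * dEA" "frame_function dP dP dAI dAI dEA dBI dBI \<Pi>A \<Phi>A"
    "\<And>UA UB. unitary_mat dAI dAI UA \<Longrightarrow> unitary_mat dBI dBI UB \<Longrightarrow>
      ?G UA UB = \<Phi>A UB * tensor_mat UA (1\<^sub>m dEA) * \<Pi>A UB"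
    using frame_function_exists[where G = ?G and dY = dBI, OF dims_pos(1,3) pure_process_Alice_decomp[OF pure' w' dims_pos(3)]]
    by blast
  \<comment> \<open>The same selection with the laboratories exchanged, applied to the induced map
    with its arguments flipped.\<close>
  obtain dEB \<Pi>B \<Phi>B where B: "dEB \<ge> 1" "dP = dBI * dEB" "frame_function dP dP dBI dBI dEB dAI dAI \<Pi>B \<Phi>B"
    "\<And>UA UB. unitary_mat dAI dAI UA \<Longrightarrow> unitary_mat dBI dBI UB \<Longrightarrow>
      ?G UA UB = \<Phi>B UA * tensor_mat UB (1\<^sub>m dEB) * \<Pi>B UA"
    using frame_function_exists[where G = "\<lambda>UB UA. ?G UA UB" and dY = dAI,
        OF dims_pos(1,5) pure_process_Bob_decomp[OF pure' w' dims_pos(5)]]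
    by blast
  show ?thesis
    unfolding dA[symmetric] dB[symmetric] dPF[symmetric]
    by (intro exI[of _ dEA] exI[of _ dEB] exI[of _ \<Pi>A] exI[of _ \<Phi>A] exI[of _ \<Pi>B] exI[of _ \<Phi>B] conjI allI impI)
      (use A B in simp_all)
qed

end
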